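(* Let $T>0$, $n\ge 1$, and for $i=1,\dots,n$ let $f_i,a_i,g_i,e_i$ satisfy: (A) for each $i$, the Green function $G_i(t,s)$ of the $T$-periodic problem for $x_i''+a_i(t)x_i=e_i(t)$ satisfies $G_i(t,s)>0$ for all $(t,s)\in[0,T]\times[0,T]$; (H1) $f_i:\mathbb{R}^n\setminus\{0\}\to\mathbb{R}$ is continuous and $f_i(x)>0$ for $|x|>0$, $i=1,\dots,n$; (H2) $a_i,g_i,e_i:\mathbb{R}\to\mathbb{R}$ are continuous and $T$-periodic, $a_i(t)\ge 0$ and $g_i(t)\ge 0$ for $t\in[0,T]$, and $\int_0^T g_i(t)\,dt>0$, $i=1,\dots,n$; (H3) $g_i(t)>0$ for $t\in[0,T]$, $i=1,\dots,n$. (No sign condition is imposed on $e_i$.) Assume that $\lim_{x\to 0}f_i(x)=\infty$ for $i=1,\dots,n$. For $\lambda>0$ consider the system $$\ddot{x}_i+a_i(t)x_i=\lambda g_i(t)f_i(x)+\lambda e_i(t),\qquad i=1,\dots,n. \quad ( * )$$ (a) If $\lim_{|x|\to\infty}f_i(x)=\infty$ and $\lim_{|x|\to\infty}\frac{f_i(x)}{|x|}=0$ for $i=1,\dots,n$, then there exists $\lambda_0>0$ such that $( * )$ has a positive $T$-periodic solution for $\lambda>\lambda_0$. (b) If $\lim_{|x|\to\infty}\frac{f_i(x)}{|x|}=\infty$ for $i=1,\dots,n$, then for all sufficiently small $\lambda>0$ the system $( * )$ has two (distinct) positive $T$-periodic solutions. (c) There exists $\lambda_1>0$ such that $( * )$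 has a positive $T$-periodic solution for $0<\lambda<\lambda_1$.
   Context: For $x=(x_1,\dots,x_n)\in\mathbb{R}^n$, $|x|=\sum_{i=1}^n|x_i|$. The Green function $G_i$ in (A) is that of the scalar problem $x_i''+a_i(t)x_i=e_i(t)$ with periodic boundary conditions $x_i(0)=x_i(T)$, $x_i'(0)=x_i'(T)$: assumption (A) includes that it exists (i.e. the homogeneous periodic problem has only the trivial solution); $G_i$ is the continuous function on $[0,T]\times[0,T]$ such that, for every continuous $T$-periodic right-hand side $h$, the unique $T$-periodic solution of $x_i''+a_i(t)x_i=h(t)$ is given on $[0,T]$ by $x_i(t)=\int_0^T G_i(t,s)h(s)\,ds$. A positive $T$-periodic solution is a $T$-periodic function $x\in C^2(\mathbb{R},\mathbb{R}^n)$ solving the system, each of whose components satisfies $x_i(t)>0$ for all $t$. "For all sufficiently small $\lambda>0$" means: there is $\lambda_*>0$ such that the assertion holds for all $0<\lambda<\lambda_*$. *)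

theory Defs
  imports "HOL-Analysis.Analysis"
begin

(* The paper's |x|: the l^1 norm, not the Euclidean norm of the type real^'n. *)
definition l1norm :: "real^'n \<Rightarrow> real" where
  "l1norm x = (\<Sum>i\<in>UNIV. \<bar>x $ i\<bar>)"

definition l1_infinity :: "(real^'n) filter" where
  "l1_infinity = filtercomap l1norm at_top"

definition T_periodic :: "real \<Rightarrow> (real \<Rightarrow> 'a) \<Rightarrow> bool" where
  "T_periodic T x \<longleftrightarrow> (\<forall>t. x (t + T) = x t)"

definition C2_with :: "(real \<Rightarrow> 'a::real_normed_vector) \<Rightarrow> (real \<Rightarrow> 'a) \<Rightarrow> bool" where
  "C2_with x x2 \<longleftrightarrow>
     (\<exists>x1. (\<forall>t. (x has_vector_derivative x1 t) (at t)) \<and>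
           (\<forall>t. (x1 has_vector_derivative x2 t) (at t)) \<and>
           continuous_on UNIV x2)"

(* The problem x'' + a(t) x = h(t) on [0,T], x(0) = x(T), x'(0) = x'(T);
   derivatives at the end points are one-sided. *)
definition periodic_bvp_solution ::
  "real \<Rightarrow> (real \<Rightarrow> real) \<Rightarrow> (real \<Rightarrow> real) \<Rightarrow> (real \<Rightarrow> real) \<Rightarrow> bool" where
  "periodic_bvp_solution T a h x \<longleftrightarrow>
     (\<exists>x1 x2.
        (\<forall>t\<in>{0..T}. (x has_vector_derivative x1 t) (at t within {0..T})) \<and>
        (\<forall>t\<in>{0..T}. (x1 has_vector_derivative x2 t) (at t within {0..T})) \<and>
        continuous_on {0..T} x2 \<and>
        (\<forall>t\<in>{0..T}. x2 t + a t * x t = h t) \<and>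
        x 0 = x T \<and> x1 0 = x1 T)"

definition scalar_periodic_solution ::
  "real \<Rightarrow> (real \<Rightarrow> real) \<Rightarrow> (real \<Rightarrow> real) \<Rightarrow> (real \<Rightarrow> real) \<Rightarrow> bool" where
  "scalar_periodic_solution T a h x \<longleftrightarrow>
     T_periodic T x \<and> (\<exists>x2. C2_with x x2 \<and> (\<forall>t. x2 t + a t * x t = h t))"

(* Only the values of G on [0,T] x [0,T] matter. *)
definition is_periodic_green_function ::
  "real \<Rightarrow> (real \<Rightarrow> real) \<Rightarrow> (real \<Rightarrow> real \<Rightarrow> real) \<Rightarrow> bool" where
  "is_periodic_green_function T a G \<longleftrightarrow>
     (\<forall>x. periodic_bvp_solution T a (\<lambda>t. 0) x \<longrightarrow> (\<forall>t\<in>{0..T}. x t = 0)) \<and>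
     continuous_on ({0..T} \<times> {0..T}) (\<lambda>(t, s). G t s) \<and>
     (\<forall>h. continuous_on UNIV h \<and> T_periodic T h \<longrightarrow>
        (\<exists>!x. scalar_periodic_solution T a h x) \<and>
        (\<forall>x. scalar_periodic_solution T a h x \<longrightarrow>
           (\<forall>t\<in>{0..T}. x t = integral {0..T} (\<lambda>s. G t s * h s))))"

(* f i is meant as a function on the punctured space; its value at 0 is irrelevant
   since a positive solution never vanishes. *)
definition positive_periodic_solution ::
  "real \<Rightarrow> ('n \<Rightarrow> real \<Rightarrow> real) \<Rightarrow> ('n \<Rightarrow> real \<Rightarrow> real) \<Rightarrow> ('n \<Rightarrow> real \<Rightarrow> real) \<Rightarrow>
   ('n \<Rightarrow> real^'n \<Rightarrow> real) \<Rightarrow> real \<Rightarrow> (real \<Rightarrow> real^'n) \<Rightarrow> bool" where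
  "positive_periodic_solution T a g e f lam x \<longleftrightarrow>
     T_periodic T x \<and>
     (\<exists>x2. C2_with x x2 \<and>
        (\<forall>t i. x2 t $ i + a i t * x t $ i = lam * g i t * f i (x t) + lam * e i t)) \<and>
     (\<forall>t i. x t $ i > 0)"

end

theory Submission
  imports Defs "HOL-Complex_Analysis.Great_Picard"
begin

text \<open>
  For a positive Green function the periodic solution operator of \<open>x'' + a x = h\<close> maps
  nonnegative \<open>h\<close> to functions whose values at any two times are comparable: with
  \<open>0 < m \<le> G \<le> M\<close> and \<open>\<sigma> = m / M\<close>, every component satisfies \<open>x(t) \<ge> \<sigma> x(s)\<close>. Functions with
  this property form a cone, on which \<open>\<nu> u = \<Sum>i. u\<^sub>i(0)\<close> measures size, linearly and up to
  the factor \<open>1 / \<sigma>\<close> at every time. A function of the cone with \<open>\<nu> u \<ge> p > 0\<close> therefore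
  avoids the singularity of \<open>f\<close> at the origin, and its right-hand side
  \<open>\<lambda> (g f(u) + e)\<close> is positive as soon as \<open>f\<close> is large on the annulus in which \<open>u\<close> has its
  values, whatever the sign of \<open>e\<close>.

  The solutions are fixed points between two sizes \<open>p < q\<close>, found where the
  integral operator pushes functions of one of the sizes outwards and pulls functions of the other
  inwards (\<open>periodic_solution_in_annulus\<close>). The abstract reason is \<open>slab_fixed_point\<close>, a
  version of Krasnoselskii's compression-expansion theorem. It reduces to Schauder's theorem because
  \<open>\<nu>\<close> is linear, so that the region between two sizes is convex. Schauder's theorem is derived from
  Kuhn's combinatorial lemma by way of finite nets.

  The growth of \<open>f\<close> decides which spheres push or pull. A fixed sphere pulls in for small \<open>\<lambda>\<close>,
  if the right-hand side is positive on it, and pushes out for large \<open>\<lambda>\<close>, if \<open>f\<close> is large on it.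
  Since \<open>f\<close> is infinite at the origin, tiny spheres push out; very large spheres
  pull in for sublinear \<open>f\<close> and push out for superlinear \<open>f\<close>. Part (a) lies between a fixed
  sphere and a large one, part (c) between a tiny sphere and a fixed one of radius \<open>R\<close>, and part (b)
  adds to this a second solution between a fixed sphere beyond \<open>R\<close> and a very large one. Their
  sizes at time 0 tell the two apart.
\<close>

section \<open>Schauder's fixed point theorem\<close>

text \<open>
  Kuhn's combinatorial lemma, with the dimension a number instead of a type, which
  Schauder's theorem needs because the dimension of its finite-dimensional approximations
  grows with the precision. A grid point gets label 0 in direction \<open>i\<close> if \<open>F\<close> does not decrease
  its \<open>i\<close>-th coordinate, and label 1 otherwise; a cell that shows both labels in every direction
  consists of points that \<open>F\<close> hardly moves.
\<close>

lemma cube_approximate_fixed_point: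
  fixes F :: "(nat \<Rightarrow> real) \<Rightarrow> nat \<Rightarrow> real" and n :: nat and \<epsilon> :: real
  defines "Q \<equiv> {c. \<forall>i<n. 0 \<le> c i \<and> c i \<le> 1}"
  assumes maps: "\<And>c i. c \<in> Q \<Longrightarrow> i < n \<Longrightarrow> 0 \<le> F c i \<and> F c i \<le> 1"
    and unif: "\<And>\<epsilon>. \<epsilon> > 0 \<Longrightarrow> \<exists>\<delta>>0. \<forall>c\<in>Q. \<forall>d\<in>Q.
        (\<forall>i<n. \<bar>c i - d i\<bar> \<le> \<delta>) \<longrightarrow> (\<forall>i<n. \<bar>F c i - F d i\<bar> \<le> \<epsilon>)"
    and "\<epsilon> > 0"
  obtains c where "c \<in> Q" "\<And>i. i < n \<Longrightarrow> \<bar>F c i - c i\<bar> \<le> \<epsilon>"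
proof -
  obtain \<delta> where "\<delta> > 0" and \<delta>: "\<And>c d i. c \<in> Q \<Longrightarrow> d \<in> Q \<Longrightarrow> (\<And>i. i < n \<Longrightarrow> \<bar>c i - d i\<bar> \<le> \<delta>)
      \<Longrightarrow> i < n \<Longrightarrow> \<bar>F c i - F d i\<bar> \<le> \<epsilon> / 2"
    using unif[of "\<epsilon> / 2"] \<open>\<epsilon> > 0\<close> by (metis half_gt_zero)
  obtain p :: nat where p: "p > 0" "1 / real p \<le> min \<delta> (\<epsilon> / 2)"
    using real_arch_inverse[of "min \<delta> (\<epsilon> / 2)"] \<open>\<delta> > 0\<close> \<open>\<epsilon> > 0\<close>
    by (auto simp: inverse_eq_divide intro: less_imp_le)
  define pt :: "(nat \<Rightarrow> nat) \<Rightarrow> nat \<Rightarrow> real" where "pt x i = real (x i) / real p" for x i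
  \<comment> \<open>The clause for the upper face forces label 1 there although \<open>F\<close> may fix the coordinate.\<close>
  define label :: "(nat \<Rightarrow> nat) \<Rightarrow> nat \<Rightarrow> nat"
    where "label x i = (if F (pt x) i \<ge> pt x i \<and> x i \<noteq> p then 0 else 1)" for x i
  have ptQ: "pt x \<in> Q" if "\<forall>i<n. x i \<le> p" for x
    using that p unfolding Q_def pt_def by (auto simp: divide_le_eq_1)
  have up: "F (pt x) i \<ge> pt x i" if "label x i = 0" for x i
    using that by (auto simp: label_def split: if_splits)
  have down: "F (pt x) i \<le> pt x i" if "label x i \<noteq> 0" "i < n" "\<forall>i<n. x i \<le> p" for x i
    using that maps[OF ptQ, of x i] p by (auto simp: label_def pt_def split: if_splits)
  obtain q where q: "\<forall>i<n. q i < p"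
    and cell: "\<forall>i<n. \<exists>r s. (\<forall>j<n. q j \<le> r j \<and> r j \<le> q j + 1) \<and>
                 (\<forall>j<n. q j \<le> s j \<and> s j \<le> q j + 1) \<and> label r i \<noteq> label s i"
  proof (rule kuhn_lemma[of p n label])
    show "\<forall>x. (\<forall>i<n. x i \<le> p) \<longrightarrow> (\<forall>i<n. x i = 0 \<longrightarrow> label x i = 0)"
      using maps ptQ p by (auto simp: label_def pt_def)
  qed (use p in \<open>auto simp: label_def\<close>)
  have qQ: "pt q \<in> Q" using q by (intro ptQ) (auto intro: less_imp_le)
  have near: "\<bar>F (pt q) i - F (pt r) i\<bar> \<le> \<epsilon> / 2 \<and> \<bar>pt q i - pt r i\<bar> \<le> \<epsilon> / 2 \<and> (\<forall>i<n. r i \<le> p)"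
    if r: "\<forall>j<n. q j \<le> r j \<and> r j \<le> q j + 1" and i: "i < n" for r i
  proof -
    have rp: "\<forall>i<n. r i \<le> p" using q r by (metis Suc_eq_plus1 Suc_leI le_trans)
    have c: "\<bar>pt q j - pt r j\<bar> \<le> 1 / real p" if "j < n" for j
    proof -
      have "\<bar>real (q j) - real (r j)\<bar> \<le> 1" using r that by (auto simp: abs_if)
      then show ?thesis using p
        by (simp add: pt_def flip: diff_divide_distrib) (simp add: divide_right_mono)
    qed
    show ?thesis using \<delta>[OF qQ ptQ[OF rp]] c p(2) i rp by (meson min.boundedE order_trans)
  qed
  show thesis
  proof (rule that[OF qQ])
    fix i assume i: "i < n"
    obtain r s where r: "\<forall>j<n. q j \<le> r j \<and> r j \<le> q j + 1" and s: "\<forall>j<n. q j \<le> s j \<and> s j \<le> q j + 1"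
      and lab: "label r i \<noteq> label s i" using cell i by blast
    have "(F (pt r) i \<ge> pt r i \<and> F (pt s) i \<le> pt s i) \<or> (F (pt s) i \<ge> pt s i \<and> F (pt r) i \<le> pt r i)"
    proof (cases "label r i = 0")
      case True
      then show ?thesis using up[of r i] down[of s i] near[OF s i] lab i by auto
    next
      case False
      then have "label s i = 0" using lab by (auto simp: label_def split: if_splits)
      then show ?thesis using up[of s i] down[of r i] near[OF r i] False i by auto
    qed
    then show "\<bar>F (pt q) i - pt q i\<bar> \<le> \<epsilon>" using near[OF r i] near[OF s i] by linarith
  qed
qed

text \<open>
  A finite net \<open>p 0, ..., p (n - 1)\<close> of the compact set reduces the problem to the cube
  \<open>[0, 1]\<^sup>n\<close>. A point \<open>c\<close> of the cube gives the average \<open>r c\<close> of the net with weights proportional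
  to \<open>c j + \<kappa>\<close>, and a vector \<open>y\<close> gives the weights \<open>\<psi> y j\<close>, which vanish unless \<open>y\<close> is
  \<open>\<epsilon>\<close>-close to \<open>p j\<close>. If \<open>c\<close> is almost fixed under \<open>\<psi> \<circ> f \<circ> r\<close>, then \<open>x = r c\<close> is mostly an average
  of net points near \<open>y = f x\<close>, hence itself near \<open>y\<close>. The offset \<open>\<kappa>\<close> keeps the total weight
  away from zero, so that \<open>r\<close> is Lipschitz on the whole cube.
\<close>

lemma schauder_approximate_fixed_point:
  fixes f :: "'a::real_normed_vector \<Rightarrow> 'a"
  assumes "convex S" "S \<noteq> {}" "continuous_on S f" and fC: "f ` S \<subseteq> C" and "compact C" "C \<subseteq> S"
    and "\<epsilon> > 0"
  obtains x where "x \<in> S" "norm (f x - x) \<le> 2 * \<epsilon>"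
proof -
  obtain P where P: "finite P" "P \<subseteq> C" and net: "C \<subseteq> (\<Union>x\<in>P. ball x (\<epsilon> / 2))"
    using seq_compact_imp_totally_bounded[of C] \<open>compact C\<close> \<open>\<epsilon> > 0\<close> half_gt_zero
    by (metis compact_eq_seq_compact_metric)
  have "C \<noteq> {}" using fC \<open>S \<noteq> {}\<close> by auto
  then have "P \<noteq> {}" using net by auto
  define n where "n = card P"
  have "n > 0" using P \<open>P \<noteq> {}\<close> by (simp add: n_def card_gt_0_iff)
  obtain p :: "nat \<Rightarrow> 'a" where p: "bij_betw p {..<n} P"
    using ex_bij_betw_nat_finite[OF P(1)] by (auto simp: n_def atLeast0LessThan)
  have pP: "p j \<in> P" if "j < n" for j using p that by (auto simp: bij_betw_def)
  obtain D where D: "D > 0" "\<And>x y. x \<in> C \<Longrightarrow> y \<in> C \<Longrightarrow> norm (x - y) \<le> D" "\<And>x. x \<in> C \<Longrightarrow> norm x \<le> D"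
  proof -
    obtain B where "B > 0" and B: "\<forall>x\<in>C. norm x \<le> B"
      using compact_imp_bounded[OF \<open>compact C\<close>] bounded_pos by metis
    have "norm (x - y) \<le> 2 * B" if "x \<in> C" "y \<in> C" for x y
      using B[rule_format, OF that(1)] B[rule_format, OF that(2)] norm_triangle_ineq4[of x y] by linarith
    then show thesis using that[of "2 * B"] B \<open>B > 0\<close> by fastforce
  qed
  \<comment> \<open>Net points far from \<open>y\<close> add at most \<open>2 * \<kappa> * D\<close> each to the weighted sum of distances, of total weight at least \<open>1/4\<close>.\<close>
  define \<kappa> where "\<kappa> = min (1/4) (\<epsilon> / (8 * real n * D))"
  have \<kappa>: "\<kappa> > 0" "\<kappa> \<le> 1/4" "\<kappa> * (8 * real n * D) \<le> \<epsilon>"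
  proof -
    show "\<kappa> > 0" "\<kappa> \<le> 1/4" using \<open>n > 0\<close> D(1) \<open>\<epsilon> > 0\<close> by (auto simp: \<kappa>_def)
    have "\<kappa> \<le> \<epsilon> / (8 * real n * D)" by (simp add: \<kappa>_def)
    then show "\<kappa> * (8 * real n * D) \<le> \<epsilon>"
      using \<open>n > 0\<close> D(1) by (simp add: pos_le_divide_eq)
  qed
  define Q where "Q = {c::nat\<Rightarrow>real. \<forall>i<n. 0 \<le> c i \<and> c i \<le> 1}"
  define W where "W c = (\<Sum>j<n. c j + \<kappa>)" for c :: "nat \<Rightarrow> real"
  define r where "r c = (\<Sum>j<n. ((c j + \<kappa>) / W c) *\<^sub>R p j)" for c :: "nat \<Rightarrow> real"
  define \<psi> where "\<psi> y j = max 0 (1 - norm (y - p j) / \<epsilon>)" for y j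
  have W: "W c \<ge> n * \<kappa>" "W c > 0" if "c \<in> Q" for c
  proof -
    have "(\<Sum>j<n. \<kappa>) \<le> W c" unfolding W_def using that by (intro sum_mono) (auto simp: Q_def)
    then show "W c \<ge> n * \<kappa>" by simp
    then show "W c > 0" using \<kappa>(1) \<open>n > 0\<close> by (smt (verit) mult_pos_pos of_nat_0_less_iff)
  qed
  have hull: "r c \<in> convex hull P" if c: "c \<in> Q" for c
  proof -
    have "(\<Sum>j<n. (c j + \<kappa>) / W c) = 1" using W[OF c] by (simp add: W_def flip: sum_divide_distrib)
    moreover have "(c j + \<kappa>) / W c \<ge> 0" if "j < n" for j
      using c that W[OF c] \<kappa>(1) by (auto simp: Q_def intro!: divide_nonneg_pos add_nonneg_nonneg)
    ultimately show ?thesis unfolding r_def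
      using pP by (intro convex_sum) (auto intro: hull_inc)
  qed
  have hullS: "convex hull P \<subseteq> S"
    using P \<open>C \<subseteq> S\<close> \<open>convex S\<close> by (meson hull_minimal order_trans)
  have Wr: "W c *\<^sub>R r c = (\<Sum>j<n. (c j + \<kappa>) *\<^sub>R p j)" if "c \<in> Q" for c
    using W[OF that] by (simp add: r_def scaleR_sum_right)
  have r_norm: "norm (r c) \<le> D" if "c \<in> Q" for c
  proof -
    have "convex hull P \<subseteq> cball 0 D" using D(3) P(2) by (intro hull_minimal) auto
    then show ?thesis using hull[OF that] by auto
  qed
  have r_lip: "norm (r c - r d) \<le> 2 * D / \<kappa> * \<delta>"
    if c: "c \<in> Q" and d: "d \<in> Q" and cd: "\<forall>i<n. \<bar>c i - d i\<bar> \<le> \<delta>" for c d \<delta>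
  proof -
    have eq: "W c *\<^sub>R (r c - r d) = (\<Sum>j<n. (c j - d j) *\<^sub>R p j) - (W c - W d) *\<^sub>R r d"
    proof -
      have "W c *\<^sub>R (r c - r d) = W c *\<^sub>R r c - W d *\<^sub>R r d - (W c - W d) *\<^sub>R r d"
        by (simp add: algebra_simps)
      also have "W c *\<^sub>R r c - W d *\<^sub>R r d = (\<Sum>j<n. (c j - d j) *\<^sub>R p j)"
        unfolding Wr[OF c] Wr[OF d] by (simp add: algebra_simps flip: sum_subtractf)
      finally show ?thesis .
    qed
    have "norm (\<Sum>j<n. (c j - d j) *\<^sub>R p j) \<le> (\<Sum>j<n. \<delta> * D)"
    proof (intro order_trans[OF norm_sum] sum_mono)
      fix j assume "j \<in> {..<n}"
      then have "\<bar>c j - d j\<bar> \<le> \<delta>" "norm (p j) \<le> D" using cd pP P D(3) by auto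
      then show "norm ((c j - d j) *\<^sub>R p j) \<le> \<delta> * D" by (simp add: mult_mono)
    qed
    moreover have "\<bar>W c - W d\<bar> \<le> n * \<delta>"
    proof -
      have "W c - W d = (\<Sum>j<n. c j - d j)" by (simp add: W_def flip: sum_subtractf)
      also have "\<bar>\<dots>\<bar> \<le> (\<Sum>j<n. \<delta>)" using cd by (intro order_trans[OF sum_abs] sum_mono) auto
      finally show ?thesis by simp
    qed
    then have "norm ((W c - W d) *\<^sub>R r d) \<le> (n * \<delta>) * D"
      using r_norm[OF d] D(1) by (auto intro!: mult_mono)
    ultimately have "norm (W c *\<^sub>R (r c - r d)) \<le> n * (2 * D * \<delta>)"
      unfolding eq using norm_triangle_ineq4[of "\<Sum>j<n. (c j - d j) *\<^sub>R p j" "(W c - W d) *\<^sub>R r d"]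
      by (simp add: algebra_simps)
    then have "W c * norm (r c - r d) \<le> n * (2 * D * \<delta>)" using W[OF c] by simp
    then have "(n * \<kappa>) * norm (r c - r d) \<le> n * (2 * D * \<delta>)"
      using W(1)[OF c] by (meson mult_right_mono norm_ge_zero order_trans)
    then have "\<kappa> * norm (r c - r d) \<le> 2 * D * \<delta>" using \<open>n > 0\<close> by simp
    then show ?thesis using \<kappa>(1) by (simp add: field_simps)
  qed
  have \<psi>_lip: "\<bar>\<psi> y j - \<psi> z j\<bar> \<le> norm (y - z) / \<epsilon>" for y z j
  proof -
    have "\<bar>norm (y - p j) - norm (z - p j)\<bar> \<le> norm (y - z)"
      using norm_triangle_ineq3[of "y - p j" "z - p j"] by simp
    then have "\<bar>norm (y - p j) / \<epsilon> - norm (z - p j) / \<epsilon>\<bar> \<le> norm (y - z) / \<epsilon>"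
      using \<open>\<epsilon> > 0\<close> by (simp add: divide_right_mono flip: diff_divide_distrib)
    then show ?thesis by (auto simp: \<psi>_def max_def abs_if split: if_splits)
  qed
  have "uniformly_continuous_on (convex hull P) f"
    using hullS \<open>continuous_on S f\<close> P(1)
    by (intro compact_uniformly_continuous finite_imp_compact_convex_hull) (auto intro: continuous_on_subset)
  then have f_unif: "\<exists>\<delta>>0. \<forall>x\<in>convex hull P. \<forall>y\<in>convex hull P. norm (x - y) < \<delta> \<longrightarrow> norm (f x - f y) < \<eta>" if "\<eta> > 0" for \<eta>
    using that unfolding uniformly_continuous_on_def dist_norm by (metis norm_minus_commute)
  obtain c where c: "c \<in> Q" "\<And>j. j < n \<Longrightarrow> \<bar>\<psi> (f (r c)) j - c j\<bar> \<le> \<kappa>"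
  proof (rule cube_approximate_fixed_point[of n "\<lambda>c. \<psi> (f (r c))" \<kappa>])
    fix \<eta> :: real assume "\<eta> > 0"
    then have "\<eta> * \<epsilon> > 0" using \<open>\<epsilon> > 0\<close> by simp
    then obtain \<delta> where "\<delta> > 0" and
      \<delta>: "\<forall>x\<in>convex hull P. \<forall>y\<in>convex hull P. norm (x - y) < \<delta> \<longrightarrow> norm (f x - f y) < \<eta> * \<epsilon>"
      using f_unif by blast
    have "\<bar>\<psi> (f (r c)) i - \<psi> (f (r d)) i\<bar> \<le> \<eta>"
      if "c \<in> Q" "d \<in> Q" "\<forall>i<n. \<bar>c i - d i\<bar> \<le> \<delta> * \<kappa> / (4 * D)" "i < n" for c d i
    proof -
      have "norm (r c - r d) \<le> \<delta> / 2" using r_lip[OF that(1-3)] \<kappa>(1) D(1) by (simp add: field_simps)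
      then have "norm (f (r c) - f (r d)) < \<eta> * \<epsilon>" using \<delta> hull that \<open>\<delta> > 0\<close> by auto
      then have "norm (f (r c) - f (r d)) / \<epsilon> \<le> \<eta>" using \<open>\<epsilon> > 0\<close> by (simp add: divide_le_eq)
      then show ?thesis using \<psi>_lip order_trans by blast
    qed
    then show "\<exists>\<delta>>0. \<forall>c\<in>{c. \<forall>i<n. 0 \<le> c i \<and> c i \<le> 1}. \<forall>d\<in>{c. \<forall>i<n. 0 \<le> c i \<and> c i \<le> 1}.
        (\<forall>i<n. \<bar>c i - d i\<bar> \<le> \<delta>) \<longrightarrow> (\<forall>i<n. \<bar>\<psi> (f (r c)) i - \<psi> (f (r d)) i\<bar> \<le> \<eta>)"
      using \<open>\<delta> > 0\<close> \<kappa>(1) D(1) unfolding Q_def by (intro exI[of _ "\<delta> * \<kappa> / (4 * D)"]) auto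
  qed (use \<open>\<epsilon> > 0\<close> \<kappa>(1) in \<open>auto simp: \<psi>_def Q_def\<close>)
  define x where "x = r c"
  define y where "y = f x"
  have "x \<in> S" using hull[OF c(1)] hullS by (auto simp: x_def)
  then have "y \<in> C" using fC by (auto simp: y_def)
  then obtain j0 where j0: "j0 < n" "norm (y - p j0) < \<epsilon> / 2"
    using net p by (force simp: bij_betw_def dist_norm norm_minus_commute)
  have c\<psi>: "\<bar>\<psi> y j - c j\<bar> \<le> \<kappa>" if "j < n" for j using c(2)[OF that] by (simp add: x_def y_def)
  have W4: "W c \<ge> 1 / 4"
  proof -
    have "norm (y - p j0) / \<epsilon> \<le> 1 / 2" using j0 \<open>\<epsilon> > 0\<close> by (simp add: field_simps)
    then have "\<psi> y j0 \<ge> 1 / 2" unfolding \<psi>_def by linarith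
    then have "1 / 4 \<le> c j0 + \<kappa>" using c\<psi>[OF j0(1)] \<kappa> by linarith
    also have "\<dots> \<le> W c" unfolding W_def
      using j0 c(1) \<kappa>(1) by (intro member_le_sum) (auto simp: Q_def)
    finally show ?thesis .
  qed
  have term_le: "(c j + \<kappa>) * norm (y - p j) \<le> (c j + \<kappa>) * \<epsilon> + 2 * \<kappa> * D" if j: "j < n" for j
  proof (cases "norm (y - p j) \<le> \<epsilon>")
    case True
    have "0 \<le> c j + \<kappa>" using c(1) j \<kappa>(1) by (auto simp: Q_def)
    then show ?thesis using mult_left_mono[OF True] \<kappa>(1) D(1)
      by (smt (verit) mult_nonneg_nonneg)
  next
    case False
    then have "\<psi> y j = 0" using \<open>\<epsilon> > 0\<close> by (simp add: \<psi>_def)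
    then have "c j + \<kappa> \<le> 2 * \<kappa>" "0 \<le> c j + \<kappa>" using c\<psi>[OF j] c(1) j \<kappa>(1) by (auto simp: Q_def)
    moreover have "norm (y - p j) \<le> D" using D(2)[OF \<open>y \<in> C\<close>] pP[OF j] P(2) by auto
    ultimately have "(c j + \<kappa>) * norm (y - p j) \<le> 2 * \<kappa> * D" by (intro mult_mono) auto
    then show ?thesis using \<open>0 \<le> c j + \<kappa>\<close> \<open>\<epsilon> > 0\<close> by (smt (verit) mult_nonneg_nonneg)
  qed
  have "W c *\<^sub>R (y - x) = (\<Sum>j<n. (c j + \<kappa>) *\<^sub>R (y - p j))"
    unfolding scaleR_diff_right x_def Wr[OF c(1)]
    by (simp add: W_def scaleR_sum_left sum_subtractf scaleR_diff_right)
  then have "W c * norm (y - x) = norm (\<Sum>j<n. (c j + \<kappa>) *\<^sub>R (y - p j))"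
    using W[OF c(1)] by (metis abs_of_pos norm_scaleR)
  also have "\<dots> \<le> (\<Sum>j<n. (c j + \<kappa>) * norm (y - p j))"
    using c(1) \<kappa>(1) by (intro order_trans[OF norm_sum] sum_mono) (auto simp: Q_def)
  also have "\<dots> \<le> (\<Sum>j<n. (c j + \<kappa>) * \<epsilon> + 2 * \<kappa> * D)" using term_le by (intro sum_mono) auto
  also have "\<dots> = W c * \<epsilon> + \<kappa> * (8 * real n * D) / 4"
    by (simp add: W_def sum.distrib flip: sum_distrib_right)
  also have "\<dots> \<le> W c * \<epsilon> + W c * \<epsilon>"
    using \<kappa>(3) mult_right_mono[OF W4, of \<epsilon>] \<open>\<epsilon> > 0\<close> by linarith
  also have "\<dots> = W c * (2 * \<epsilon>)" by simp
  finally have "norm (y - x) \<le> 2 * \<epsilon>" using W[OF c(1)] by simp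
  then show thesis using that[OF \<open>x \<in> S\<close>] by (simp add: y_def)
qed

text \<open>
  The images of points moved less and less accumulate in the compact set, and so do the points.
\<close>

theorem schauder_fixed_point:
  fixes f :: "'a::real_normed_vector \<Rightarrow> 'a"
  assumes "convex S" "S \<noteq> {}" "continuous_on S f" "f ` S \<subseteq> C" "compact C" "C \<subseteq> S"
  obtains x where "x \<in> S" "f x = x"
proof -
  have "\<exists>x\<in>S. norm (f x - x) \<le> 2 * inverse (real (Suc k))" for k
    using schauder_approximate_fixed_point[OF assms, of "inverse (real (Suc k))"] by fastforce
  then obtain x where xS: "\<And>k. x k \<in> S" and x: "\<And>k. norm (f (x k) - x k) \<le> 2 * inverse (real (Suc k))"
    by metis
  have "\<forall>k. f (x k) \<in> C" using xS assms by auto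
  then obtain z and s :: "nat \<Rightarrow> nat" where "z \<in> C" and s: "strict_mono s" and fz: "(\<lambda>k. f (x (s k))) \<longlonglongrightarrow> z"
    using \<open>compact C\<close>[unfolded compact_def, rule_format, of "\<lambda>k. f (x k)"] by (auto simp: o_def)
  have "(\<lambda>k. 2 * inverse (real (Suc k))) \<longlonglongrightarrow> 0"
    using tendsto_mult_right_zero[OF LIMSEQ_inverse_real_of_nat] .
  then have "(\<lambda>k. f (x k) - x k) \<longlonglongrightarrow> 0"
    by (rule Lim_null_comparison[rotated]) (simp add: x del: of_nat_Suc)
  then have "(\<lambda>k. f (x (s k)) - x (s k)) \<longlonglongrightarrow> 0"
    using LIMSEQ_subseq_LIMSEQ[OF _ s] by (auto simp: o_def)
  from tendsto_diff[OF fz this] have xz: "(\<lambda>k. x (s k)) \<longlonglongrightarrow> z" by simp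
  have "z \<in> S" using \<open>z \<in> C\<close> \<open>C \<subseteq> S\<close> by auto
  then have "(\<lambda>k. f (x (s k))) \<longlonglongrightarrow> f z"
    using \<open>continuous_on S f\<close> xS xz unfolding continuous_on_sequentially by (auto simp: o_def)
  then have "f z = z" using fz LIMSEQ_unique by blast
  then show thesis using that \<open>z \<in> S\<close> by blast
qed

section \<open>Compression and expansion between two sizes\<close>

text \<open>
  A form of Krasnoselskii's theorem on cone compression and expansion. Measuring size in the
  cone \<open>K\<close> by a linear functional \<open>\<nu>\<close> instead of a norm makes the region between two sizes convex,
  so that Schauder's theorem applies to it without retractions or an index.

  The given \<open>F\<close> need not map the slab to itself. Keep the direction of \<open>F x\<close> and replace its
  size \<open>\<nu> (F x)\<close> by \<open>\<phi> x\<close>, a number in \<open>[p, q]\<close>. In the compressive case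
  \<open>\<phi> x\<close> is the size of \<open>F x\<close>, cut off at \<open>p\<close> and \<open>q\<close>. In the expansive case the deviation of
  the size is reflected first: \<open>2 * \<nu> x - \<nu> (F x)\<close> replaces \<open>\<nu> (F x)\<close>, and expansion becomes
  compression. In both cases a fixed point of the new map satisfies \<open>\<nu> x = \<phi> x\<close>, the boundary
  condition rules out that the cut-off changed a number, and hence \<open>\<nu> x = \<nu> (F x)\<close>.
\<close>

theorem slab_fixed_point:
  fixes F :: "'a::real_normed_vector \<Rightarrow> 'a" and \<nu> :: "'a \<Rightarrow> real"
  defines "S K p q \<equiv> {x \<in> K. p \<le> \<nu> x \<and> \<nu> x \<le> q}"
  assumes "convex K" and scale: "\<And>x t. x \<in> K \<Longrightarrow> t > 0 \<Longrightarrow> t *\<^sub>R x \<in> K"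
    and "bounded_linear \<nu>"
    and "0 < p" "p \<le> q" and "S K p q \<noteq> {}"
    and contF: "continuous_on (S K p q) F" and FC: "F ` S K p q \<subseteq> C" and "compact C" "C \<subseteq> K"
    and \<nu>_pos: "\<And>x. x \<in> C \<Longrightarrow> \<nu> x > 0"
    and boundary:
      "(\<forall>x\<in>S K p q. (\<nu> x = p \<longrightarrow> p \<le> \<nu> (F x)) \<and> (\<nu> x = q \<longrightarrow> \<nu> (F x) \<le> q)) \<or>
       (\<forall>x\<in>S K p q. (\<nu> x = p \<longrightarrow> \<nu> (F x) \<le> p) \<and> (\<nu> x = q \<longrightarrow> q \<le> \<nu> (F x)))"
  obtains x where "x \<in> S K p q" "F x = x"
proof -
  interpret \<nu>: bounded_linear \<nu> by fact
  let ?S = "S K p q"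
  have cont\<nu>: "continuous_on A \<nu>" for A
    using \<nu>.bounded_linear_axioms by (rule linear_continuous_on)
  define compressive where
    "compressive \<longleftrightarrow> (\<forall>x\<in>?S. (\<nu> x = p \<longrightarrow> p \<le> \<nu> (F x)) \<and> (\<nu> x = q \<longrightarrow> \<nu> (F x) \<le> q))"
  define height where
    "height x = (if compressive then \<nu> (F x) else 2 * \<nu> x - \<nu> (F x))" for x
  define \<phi> where "\<phi> x = min q (max p (height x))" for x
  define H where "H x = (\<phi> x / \<nu> (F x)) *\<^sub>R F x" for x
  have \<phi>: "p \<le> \<phi> x" "\<phi> x \<le> q" for x using \<open>p \<le> q\<close> by (auto simp: \<phi>_def)
  have pos: "\<nu> (F x) > 0" if "x \<in> ?S" for x using \<nu>_pos FC that by auto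
  have cont_\<nu>F: "continuous_on ?S (\<lambda>x. \<nu> (F x))"
    using continuous_on_compose2[OF cont\<nu>[of UNIV] contF] by auto
  have "continuous_on ?S height"
    unfolding height_def by (cases compressive) (auto intro!: continuous_intros cont_\<nu>F cont\<nu>)
  then have contH: "continuous_on ?S H"
    unfolding H_def \<phi>_def using pos
    by (intro continuous_intros cont_\<nu>F contF) (fastforce dest: pos)+
  define D where "D = (\<lambda>(s, v). (s / \<nu> v) *\<^sub>R v) ` ({p..q} \<times> C)"
  have "compact D" unfolding D_def
  proof (intro compact_continuous_image compact_Times \<open>compact C\<close> compact_Icc)
    show "continuous_on ({p..q} \<times> C) (\<lambda>(s, v). (s / \<nu> v) *\<^sub>R v)"
      unfolding case_prod_unfold
    proof (intro continuous_intros)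
      show "continuous_on ({p..q} \<times> C) (\<lambda>x. \<nu> (snd x))"
        by (rule continuous_on_compose2[OF cont\<nu>[of UNIV] continuous_on_snd[OF continuous_on_id]]) auto
    qed (use \<nu>_pos in fastforce)
  qed
  have "D \<subseteq> ?S"
  proof
    fix y assume "y \<in> D"
    then obtain s v where y: "y = (s / \<nu> v) *\<^sub>R v" "s \<in> {p..q}" "v \<in> C" by (auto simp: D_def)
    then have "\<nu> y = s" "s / \<nu> v > 0" using \<nu>_pos[of v] \<open>0 < p\<close> by (auto simp: \<nu>.scaleR)
    then show "y \<in> ?S" using y scale \<open>C \<subseteq> K\<close> unfolding S_def by auto
  qed
  have "H ` ?S \<subseteq> D"
  proof
    fix y assume "y \<in> H ` ?S"
    then obtain x where "x \<in> ?S" "y = (\<phi> x / \<nu> (F x)) *\<^sub>R F x" by (auto simp: H_def)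
    then show "y \<in> D" unfolding D_def using \<phi> FC
      by (intro image_eqI[of _ _ "(\<phi> x, F x)"]) auto
  qed
  have "convex ?S"
  proof -
    have "?S = K \<inter> \<nu> -` {p..q}" by (auto simp: S_def)
    then show ?thesis using \<open>convex K\<close> \<nu>.linear_axioms
      by (simp add: convex_Int convex_linear_vimage)
  qed
  then obtain x where x: "x \<in> ?S" "H x = x"
    using schauder_fixed_point[OF _ \<open>?S \<noteq> {}\<close> contH \<open>H ` ?S \<subseteq> D\<close> \<open>compact D\<close> \<open>D \<subseteq> ?S\<close>] by blast
  have "\<nu> (H x) = \<phi> x" using pos[OF x(1)] by (simp add: H_def \<nu>.scaleR)
  then have \<nu>x: "\<nu> x = \<phi> x" using x by simp
  have "\<nu> (F x) = \<nu> x"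
  proof (cases compressive)
    case True
    then have "(\<nu> x = p \<longrightarrow> p \<le> \<nu> (F x)) \<and> (\<nu> x = q \<longrightarrow> \<nu> (F x) \<le> q)"
      using x(1) by (auto simp: compressive_def)
    then show ?thesis using \<nu>x True \<open>p \<le> q\<close>
      unfolding \<phi>_def height_def by (simp add: min_def max_def split: if_splits)
  next
    case False
    then have "(\<nu> x = p \<longrightarrow> \<nu> (F x) \<le> p) \<and> (\<nu> x = q \<longrightarrow> q \<le> \<nu> (F x))"
      using x(1) boundary by (auto simp: compressive_def)
    then show ?thesis using \<nu>x False \<open>p \<le> q\<close>
      unfolding \<phi>_def height_def by (simp add: min_def max_def split: if_splits)
  qed
  then have "F x = x" using x(2) \<nu>x pos[OF x(1)] by (simp add: H_def)
  then show thesis using that x(1) by blast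
qed

section \<open>Periodic functions\<close>

text \<open>
  The representative depends on \<open>t\<close> only, so that one choice serves several periodic functions.
\<close>

lemma periodic_representative:
  assumes "T > 0"
  obtains s where "s \<in> {0..T}" "\<And>x :: real \<Rightarrow> 'a. T_periodic T x \<Longrightarrow> x t = x s"
proof -
  have shift: "x (t + of_nat k * T) = x t" if "T_periodic T x" for x :: "real \<Rightarrow> 'a" and k t
  proof (induction k)
    case (Suc k)
    have "x (t + of_nat (Suc k) * T) = x ((t + of_nat k * T) + T)" by (simp add: algebra_simps)
    then show ?case using Suc that by (simp add: T_periodic_def)
  qed simp
  define j where "j = \<lfloor>t / T\<rfloor>"
  define s where "s = t - of_int j * T"
  have "of_int j \<le> t / T" "t / T < of_int j + 1" by (auto simp: j_def) 
  then have "s \<in> {0..T}" using assms by (simp add: s_def field_simps)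
  moreover have "x t = x s" if "T_periodic T x" for x :: "real \<Rightarrow> 'a"
  proof (cases "j \<ge> 0")
    case True
    then show ?thesis using shift[OF that, of s "nat j"] by (simp add: s_def)
  next
    case False
    then show ?thesis using shift[OF that, of t "nat (- j)"] by (simp add: s_def)
  qed
  ultimately show thesis using that by blast
qed

lemma has_vector_derivative_vec_lambda:
  fixes x :: "'n::finite \<Rightarrow> real \<Rightarrow> real"
  assumes "\<And>i. (x i has_vector_derivative x' i) (at t within A)"
  shows "((\<lambda>t. \<chi> i. x i t) has_vector_derivative (\<chi> i. x' i)) (at t within A)"
  using assms unfolding has_vector_derivative_def
  by (subst has_derivative_componentwise_within) (auto simp: Basis_vec_def inner_axis)

lemma periodic_bcontfun_dist_le:
  fixes u v :: "real \<Rightarrow>\<^sub>C 'b::real_normed_vector"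
  assumes "T > 0" "T_periodic T u" "T_periodic T v"
    and "\<And>t. t \<in> {0..T} \<Longrightarrow> norm (u t - v t) \<le> b"
  shows "dist u v \<le> b"
proof (rule dist_bound)
  fix t
  obtain s where "s \<in> {0..T}" "\<And>x :: real \<Rightarrow> 'b. T_periodic T x \<Longrightarrow> x t = x s"
    using periodic_representative[OF \<open>T > 0\<close>] by blast
  then show "dist (u t) (v t) \<le> b" using assms by (metis dist_norm)
qed

text \<open>
  Periodicity turns uniform convergence on one period into convergence in the supremum norm over
  the whole line; completeness of the space of bounded continuous functions supplies the limit.
\<close>

lemma periodic_Arzela_Ascoli:
  fixes v :: "nat \<Rightarrow> real \<Rightarrow>\<^sub>C 'b::euclidean_space"
  assumes "T > 0" and per: "\<And>n. T_periodic T (v n)"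
    and bd: "\<And>n t. t \<in> {0..T} \<Longrightarrow> norm (v n t) \<le> B"
    and equi: "\<And>t e. t \<in> {0..T} \<Longrightarrow> e > 0 \<Longrightarrow>
        \<exists>d>0. \<forall>n s. s \<in> {0..T} \<and> norm (t - s) < d \<longrightarrow> norm (v n t - v n s) < e"
  obtains l k where "strict_mono (k :: nat \<Rightarrow> nat)" "(\<lambda>n. v (k n)) \<longlonglongrightarrow> l"
proof -
  obtain gl k where k: "strict_mono (k :: nat \<Rightarrow> nat)"
    and lim: "\<And>e. 0 < e \<Longrightarrow> \<exists>N. \<forall>n t. n \<ge> N \<and> t \<in> {0..T} \<longrightarrow> norm (v (k n) t - gl t) < e"
  proof (rule Arzela_Ascoli[of "{0..T}" "\<lambda>n. apply_bcontfun (v n)" B])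
    show "\<exists>d. 0 < d \<and> (\<forall>n s. s \<in> {0..T} \<and> norm (t - s) < d \<longrightarrow> norm (v n t - v n s) < e)"
      if "t \<in> {0..T}" "e > 0" for t e using equi[OF that] .
  qed (use bd in blast)+
  have "Cauchy (\<lambda>n. v (k n))"
  proof (rule metric_CauchyI)
    fix e :: real assume "e > 0"
    then obtain N where N: "\<And>n t. n \<ge> N \<Longrightarrow> t \<in> {0..T} \<Longrightarrow> norm (v (k n) t - gl t) < e / 3"
      using lim[of "e / 3"] by auto
    have "dist (v (k i)) (v (k j)) < e" if "i \<ge> N" "j \<ge> N" for i j
    proof -
      have "norm (v (k i) t - v (k j) t) \<le> 2 * (e / 3)" if "t \<in> {0..T}" for t
        using N[OF \<open>i \<ge> N\<close> that] N[OF \<open>j \<ge> N\<close> that] norm_diff_triangle_ineq[of "v (k i) t" "- gl t" "gl t" "v (k j) t"]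
          norm_triangle_ineq4[of "v (k i) t - gl t" "v (k j) t - gl t"] by simp
      then have "dist (v (k i)) (v (k j)) \<le> 2 * (e / 3)"
        by (rule periodic_bcontfun_dist_le[OF \<open>T > 0\<close> per per])
      then show ?thesis using \<open>e > 0\<close> by simp
    qed
    then show "\<exists>N. \<forall>i\<ge>N. \<forall>j\<ge>N. dist (v (k i)) (v (k j)) < e" by blast
  qed
  then show thesis using that[OF k] by (metis Cauchy_convergent_iff convergent_def)
qed

lemma bcontfun_tendsto_pointwise:
  fixes l :: "real \<Rightarrow>\<^sub>C 'b::metric_space"
  assumes "(\<lambda>n. v n) \<longlonglongrightarrow> l"
  shows "(\<lambda>n. v n t) \<longlonglongrightarrow> l t"
  using tendsto_uniform_limitI[OF tendsto_bcontfun_uniform_limit[OF assms], of t] by simp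

section \<open>The periodic solution operator\<close>

text \<open>
  On the compact square the positive kernels lie between two positive constants, and these bounds,
  with the representation of periodic solutions by the kernel, carry all estimates below.
\<close>

locale green_bounds =
  fixes T :: real and a :: "'n::finite \<Rightarrow> real \<Rightarrow> real" and G :: "'n \<Rightarrow> real \<Rightarrow> real \<Rightarrow> real"
    and m M :: real
  assumes T_pos: "T > 0"
    and green: "\<And>i. is_periodic_green_function T (a i) (G i)"
    and m_pos: "m > 0"
    and G_bounds: "\<And>i t s. t \<in> {0..T} \<Longrightarrow> s \<in> {0..T} \<Longrightarrow> m \<le> G i t s \<and> G i t s \<le> M"
begin

lemma m_le_M: "m \<le> M"
  using G_bounds[of 0 0 undefined] T_pos by auto

definition \<sigma> :: real where "\<sigma> = m / M"

lemma \<sigma>: "\<sigma> > 0" "\<sigma> \<le> 1"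
  using m_pos m_le_M by (auto simp: \<sigma>_def)

definition sol :: "'n \<Rightarrow> (real \<Rightarrow> real) \<Rightarrow> real \<Rightarrow> real" where
  "sol i h = (THE x. scalar_periodic_solution T (a i) h x)"

context
  fixes h :: "real \<Rightarrow> real"
  assumes h: "continuous_on UNIV h" "T_periodic T h"
begin

lemma sol_solves: "scalar_periodic_solution T (a i) h (sol i h)"
  using green[of i] h unfolding is_periodic_green_function_def sol_def by (metis theI')

lemma sol_integral: "t \<in> {0..T} \<Longrightarrow> sol i h t = integral {0..T} (\<lambda>s. G i t s * h s)"
  using green[of i] h sol_solves[of i] unfolding is_periodic_green_function_def by blast

lemma sol_periodic: "T_periodic T (sol i h)"
  using sol_solves[of i] by (auto simp: scalar_periodic_solution_def)

lemma sol_continuous: "continuous_on A (sol i h)"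
proof -
  obtain x1 where "\<And>t. (sol i h has_vector_derivative x1 t) (at t)"
    using sol_solves[of i] unfolding scalar_periodic_solution_def C2_with_def by blast
  then show ?thesis
    by (meson continuous_at_imp_continuous_on has_vector_derivative_continuous)
qed

lemma kernel_integrable: "t \<in> {0..T} \<Longrightarrow> (\<lambda>s. G i t s * h s) integrable_on {0..T}"
proof (rule integrable_continuous_real, intro continuous_on_mult)
  assume t: "t \<in> {0..T}"
  have "continuous_on ({0..T} \<times> {0..T}) (\<lambda>(t, s). G i t s)"
    using green[of i] by (simp add: is_periodic_green_function_def)
  then have "continuous_on {0..T} (\<lambda>s. (\<lambda>(t, s). G i t s) (t, s))"
    by (rule continuous_on_compose2) (use t in \<open>auto intro!: continuous_intros\<close>)
  then show "continuous_on {0..T} (G i t)" by simp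
qed (use h in \<open>auto intro: continuous_on_subset\<close>)

lemma h_integrable: "h integrable_on {0..T}"
  using h by (auto intro!: integrable_continuous_real intro: continuous_on_subset)

lemma sol_between:
  assumes "\<And>s. s \<in> {0..T} \<Longrightarrow> 0 \<le> h s"
  shows "m * integral {0..T} h \<le> sol i h t" "sol i h t \<le> M * integral {0..T} h"
proof -
  obtain s where s: "s \<in> {0..T}" "sol i h t = sol i h s"
    using periodic_representative[OF T_pos, where 'a=real] sol_periodic by metis
  have "integral {0..T} (\<lambda>s. m * h s) \<le> sol i h s"
    unfolding sol_integral[OF s(1)]
    using s G_bounds assms by (intro integral_le kernel_integrable integrable_on_mult_right h_integrable) (auto intro!: mult_right_mono)
  moreover have "sol i h s \<le> integral {0..T} (\<lambda>s. M * h s)"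
    unfolding sol_integral[OF s(1)]
    using s G_bounds assms by (intro integral_le kernel_integrable integrable_on_mult_right h_integrable) (auto intro!: mult_right_mono)
  ultimately show "m * integral {0..T} h \<le> sol i h t" "sol i h t \<le> M * integral {0..T} h"
    using s by simp_all
qed

lemma sol_ge:
  assumes "c \<ge> 0" "\<And>s. s \<in> {0..T} \<Longrightarrow> c \<le> h s"
  shows "m * T * c \<le> sol i h t"
proof -
  have "integral {0..T} (\<lambda>s. c) \<le> integral {0..T} h"
    using assms by (intro integral_le h_integrable) auto
  then have "m * (T * c) \<le> m * integral {0..T} h" using T_pos m_pos by simp
  also have "\<dots> \<le> sol i h t" using assms order_trans by (intro sol_between) blast
  finally show ?thesis by (simp add: mult.assoc)
qed

lemma sol_le:
  assumes "\<And>s. s \<in> {0..T} \<Longrightarrow> 0 \<le> h s" "\<And>s. s \<in> {0..T} \<Longrightarrow> h s \<le> c"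
  shows "sol i h t \<le> M * T * c"
proof -
  have "integral {0..T} h \<le> integral {0..T} (\<lambda>s. c)"
    using assms by (intro integral_le h_integrable) auto
  then have "M * integral {0..T} h \<le> M * (T * c)" using T_pos m_pos m_le_M by simp
  then show ?thesis using sol_between(2)[OF assms(1), of i t] by (simp add: mult.assoc)
qed

text \<open>
  The Harnack inequality behind the choice of the cone: all values of a solution lie between
  \<open>m\<close> and \<open>M\<close> times the same integral.
\<close>

lemma sol_harnack:
  assumes "\<And>s. s \<in> {0..T} \<Longrightarrow> 0 \<le> h s"
  shows "\<sigma> * sol i h s \<le> sol i h t"
proof -
  have "\<sigma> * sol i h s \<le> \<sigma> * (M * integral {0..T} h)"
    using sol_between(2)[OF assms] \<sigma> by (intro mult_left_mono) auto
  also have "\<dots> = m * integral {0..T} h" using m_pos m_le_M by (simp add: \<sigma>_def)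
  finally show ?thesis using sol_between(1)[OF assms] order_trans by blast
qed

text \<open>
  The modulus of continuity of a solution in terms of the kernel and a bound of the right-hand
  side. This form passes to pointwise limits, which the compactness proof uses.
\<close>

lemma sol_modulus:
  assumes B: "\<And>s. s \<in> {0..T} \<Longrightarrow> \<bar>h s\<bar> \<le> B"
    and t: "t \<in> {0..T}" "t' \<in> {0..T}" and G: "\<And>s. s \<in> {0..T} \<Longrightarrow> \<bar>G i t s - G i t' s\<bar> \<le> \<eta>"
  shows "\<bar>sol i h t - sol i h t'\<bar> \<le> T * B * \<eta>"
proof -
  have "sol i h t - sol i h t' = integral {0..T} (\<lambda>s. G i t s * h s - G i t' s * h s)"
    using t by (simp add: sol_integral integral_diff kernel_integrable)
  also have "norm \<dots> \<le> integral {0..T} (\<lambda>s. B * \<eta>)"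
  proof (rule integral_norm_bound_integral)
    fix s assume s: "s \<in> {0..T}"
    have "norm (G i t s * h s - G i t' s * h s) = \<bar>h s\<bar> * \<bar>G i t s - G i t' s\<bar>"
      by (simp add: left_diff_distrib[symmetric] abs_mult)
    also have "\<dots> \<le> B * \<eta>" using B[OF s] G[OF s] by (intro mult_mono) auto
    finally show "norm (G i t s * h s - G i t' s * h s) \<le> B * \<eta>" .
  qed (use t in \<open>auto intro!: integrable_diff kernel_integrable\<close>)
  finally show ?thesis using T_pos by (simp add: ac_simps)
qed

end

lemma sol_diff:
  assumes h: "continuous_on UNIV h" "T_periodic T h" and k: "continuous_on UNIV k" "T_periodic T k"
    and \<eta>: "\<And>s. s \<in> {0..T} \<Longrightarrow> \<bar>h s - k s\<bar> \<le> \<eta>"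
    and t: "t \<in> {0..T}"
  shows "\<bar>sol i h t - sol i k t\<bar> \<le> T * M * \<eta>"
proof -
  have "sol i h t - sol i k t = integral {0..T} (\<lambda>s. G i t s * h s - G i t s * k s)"
    using t by (simp add: sol_integral h k integral_diff kernel_integrable)
  also have "norm \<dots> \<le> integral {0..T} (\<lambda>s. M * \<eta>)"
  proof (rule integral_norm_bound_integral)
    fix s assume s: "s \<in> {0..T}"
    have "norm (G i t s * h s - G i t s * k s) = \<bar>G i t s\<bar> * \<bar>h s - k s\<bar>"
      by (simp add: right_diff_distrib[symmetric] abs_mult)
    also have "\<dots> \<le> M * \<eta>" using \<eta>[OF s] G_bounds[OF t s, of i] m_pos by (intro mult_mono) auto
    finally show "norm (G i t s * h s - G i t s * k s) \<le> M * \<eta>" .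
  qed (use t in \<open>auto intro!: integrable_diff kernel_integrable h k\<close>)
  finally show ?thesis using T_pos by (simp add: ac_simps)
qed

lemma G_equicontinuous:
  assumes "e > 0"
  obtains d where "d > 0" "\<And>i t t' s. t \<in> {0..T} \<Longrightarrow> t' \<in> {0..T} \<Longrightarrow> s \<in> {0..T} \<Longrightarrow> \<bar>t - t'\<bar> < d
     \<Longrightarrow> \<bar>G i t s - G i t' s\<bar> \<le> e"
proof -
  have "\<exists>d>0. \<forall>t\<in>{0..T}. \<forall>t'\<in>{0..T}. \<forall>s\<in>{0..T}. \<bar>t - t'\<bar> < d \<longrightarrow> \<bar>G i t s - G i t' s\<bar> \<le> e" for i
  proof -
    have "continuous_on ({0..T} \<times> {0..T}) (\<lambda>(t, s). G i t s)"
      using green[of i] by (simp add: is_periodic_green_function_def)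
    then have "uniformly_continuous_on ({0..T} \<times> {0..T}) (\<lambda>(t, s). G i t s)"
      by (intro compact_uniformly_continuous compact_Times) auto
    then obtain d where "d > 0" and d: "\<And>x y. x \<in> {0..T} \<times> {0..T} \<Longrightarrow> y \<in> {0..T} \<times> {0..T} \<Longrightarrow> dist y x < d
        \<Longrightarrow> dist ((\<lambda>(t, s). G i t s) y) ((\<lambda>(t, s). G i t s) x) < e"
      using assms unfolding uniformly_continuous_on_def by metis
    have "\<bar>G i t s - G i t' s\<bar> \<le> e"
      if "t \<in> {0..T}" "t' \<in> {0..T}" "s \<in> {0..T}" "\<bar>t - t'\<bar> < d" for t t' s
      using d[of "(t', s)" "(t, s)"] that by (simp add: dist_Pair_Pair dist_real_def)
    then show ?thesis using \<open>d > 0\<close> by blast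
  qed
  then obtain d where d0: "\<And>i. d i > 0" and d: "\<And>i t t' s. t\<in>{0..T} \<Longrightarrow> t'\<in>{0..T} \<Longrightarrow> s\<in>{0..T} \<Longrightarrow> \<bar>t - t'\<bar> < d i \<Longrightarrow> \<bar>G i t s - G i t' s\<bar> \<le> e"
    by metis
  show thesis
  proof (rule that[of "Min (range d)"])
    show "Min (range d) > 0" using d0 by (subst Min_gr_iff) auto
    fix i t t' s assume A: "t \<in> {0..T}" "t' \<in> {0..T}" "s \<in> {0..T}" "\<bar>t - t'\<bar> < Min (range d)"
    have "Min (range d) \<le> d i" by (intro Min_le) auto
    then show "\<bar>G i t s - G i t' s\<bar> \<le> e" using d A by auto
  qed
qed

section \<open>Positive periodic solutions between two sizes\<close>

text \<open>
  The values of the functions of the cone below whose size is between \<open>p\<close> and \<open>q\<close>: by the Harnack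
  inequality the sum of the components varies along the function by a factor of at most
  \<open>1 / \<sigma>\<close>. For \<open>p > 0\<close> such values stay away from the singularity at the origin.
\<close>

definition annulus :: "real \<Rightarrow> real \<Rightarrow> (real^'n) set" where
  "annulus p q = {y. (\<forall>j. 0 \<le> y $ j) \<and> \<sigma> * p \<le> l1norm y \<and> l1norm y \<le> q / \<sigma>}"

definition harnack_cone :: "(real \<Rightarrow>\<^sub>C (real^'n)) set" where
  "harnack_cone = {u :: real \<Rightarrow>\<^sub>C (real^'n). T_periodic T u \<and> (\<forall>t i. 0 \<le> u t $ i) \<and> (\<forall>s t i. \<sigma> * u s $ i \<le> u t $ i)}"

text \<open>
  On the cone, the l1 norm of the value at time 0, but linear in the function.
\<close>

definition \<nu> :: "(real \<Rightarrow>\<^sub>C (real^'n)) \<Rightarrow> real" where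
  "\<nu> u = (\<Sum>i\<in>UNIV. u 0 $ i)"

lemma le_sum_const: "r \<le> (\<Sum>i\<in>(UNIV::'n set). r)" if "r > 0" for r :: real
proof -
  have "1 \<le> CARD('n)" by (simp add: Suc_le_eq)
  then show ?thesis using mult_right_mono[of 1 "real CARD('n)" r] that by simp
qed

lemma l1norm_nonneg: "l1norm y = (\<Sum>i\<in>UNIV. y $ i)" if "\<forall>j. 0 \<le> y $ j"
  using that by (simp add: l1norm_def)

text \<open>
  Functions of the cone that have size \<open>r\<close> have their values in \<^term>\<open>annulus r r\<close>. The
  nonlinearity is weighed there against the kernel bounds, so that the size of the image of a
  function is compared with the size of the function by looking at values of \<open>N\<close> only.
\<close>

definition pushes_out :: "('n \<Rightarrow> real \<Rightarrow> real^'n \<Rightarrow> real) \<Rightarrow> real \<Rightarrow> bool" where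
  "pushes_out N r \<longleftrightarrow> (\<forall>i. \<forall>t\<in>{0..T}. \<forall>y\<in>annulus r r. r \<le> m * T * N i t y)"

definition pulls_in :: "('n \<Rightarrow> real \<Rightarrow> real^'n \<Rightarrow> real) \<Rightarrow> real \<Rightarrow> bool" where
  "pulls_in N r \<longleftrightarrow> (\<forall>i. \<forall>t\<in>{0..T}. \<forall>y\<in>annulus r r. M * T * (real CARD('n) * N i t y) \<le> r)"

lemma compact_annulus: "compact (annulus p q)"
proof -
  have "closed (annulus p q)"
    unfolding annulus_def l1norm_def by (intro closed_Collect_conj closed_Collect_all closed_Collect_le continuous_intros)
  moreover have "bounded (annulus p q)"
    unfolding bounded_iff annulus_def l1norm_def using norm_le_l1_cart order_trans by blast
  ultimately show ?thesis using compact_eq_bounded_closed by blast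
qed

lemma annulus_nonzero: "y \<noteq> 0" if "y \<in> annulus p q" "p > 0"
  using that mult_pos_pos[OF \<sigma>(1) that(2)] by (auto simp: annulus_def l1norm_def)

lemma harnack_cone_in_annulus: "u t \<in> annulus p q" if u: "u \<in> harnack_cone" and "p \<le> \<nu> u" "\<nu> u \<le> q"
proof -
  have nn: "\<forall>t i. 0 \<le> u t $ i" and h: "\<And>s t i. \<sigma> * u s $ i \<le> u t $ i" using u by (auto simp: harnack_cone_def)
  have "\<sigma> * \<nu> u \<le> l1norm (u t)"
    unfolding \<nu>_def l1norm_nonneg[OF nn[rule_format, THEN allI]] sum_distrib_left
    by (intro sum_mono h)
  moreover have "\<sigma> * l1norm (u t) \<le> \<nu> u"
    unfolding \<nu>_def l1norm_nonneg[OF nn[rule_format, THEN allI]] sum_distrib_left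
    by (intro sum_mono h)
  moreover have "\<sigma> * p \<le> \<sigma> * \<nu> u" using that \<sigma> by simp
  ultimately have "\<sigma> * p \<le> l1norm (u t)" "\<sigma> * l1norm (u t) \<le> q" using that by linarith+
  then show ?thesis using \<sigma> nn by (simp add: annulus_def pos_le_divide_eq mult.commute)
qed

lemma bounded_linear_\<nu>: "bounded_linear \<nu>"
proof (rule bounded_linear_intro[where K = "real CARD('n)"])
  fix u :: "real \<Rightarrow>\<^sub>C (real^'n)"
  have "\<bar>\<nu> u\<bar> \<le> (\<Sum>i\<in>(UNIV::'n set). norm u)"
    unfolding \<nu>_def
    by (intro order_trans[OF sum_abs] sum_mono) (meson component_le_norm_cart norm_bounded order_trans)
  then show "norm (\<nu> u) \<le> norm u * real CARD('n)" by (simp add: mult.commute)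
qed (simp_all add: \<nu>_def sum.distrib sum_distrib_left)

lemma convex_harnack_cone: "convex harnack_cone"
proof (rule convexI)
  fix u v :: "real \<Rightarrow>\<^sub>C (real^'n)" and \<alpha> \<beta> :: real
  assume u: "u \<in> harnack_cone" and v: "v \<in> harnack_cone" and "0 \<le> \<alpha>" "0 \<le> \<beta>" "\<alpha> + \<beta> = 1"
  have "\<sigma> * (\<alpha> * u s $ i + \<beta> * v s $ i) \<le> \<alpha> * u t $ i + \<beta> * v t $ i" for s t i
  proof -
    have "\<alpha> * (\<sigma> * u s $ i) \<le> \<alpha> * u t $ i" "\<beta> * (\<sigma> * v s $ i) \<le> \<beta> * v t $ i"
      using u v \<open>0 \<le> \<alpha>\<close> \<open>0 \<le> \<beta>\<close> by (auto simp: harnack_cone_def intro!: mult_left_mono)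
    then show ?thesis by (simp add: algebra_simps)
  qed
  then show "\<alpha> *\<^sub>R u + \<beta> *\<^sub>R v \<in> harnack_cone"
    using u v \<open>0 \<le> \<alpha>\<close> \<open>0 \<le> \<beta>\<close> by (auto simp: harnack_cone_def T_periodic_def)
qed

lemma harnack_cone_scaleR: "u \<in> harnack_cone \<Longrightarrow> r > 0 \<Longrightarrow> r *\<^sub>R u \<in> harnack_cone"
  by (auto simp: harnack_cone_def T_periodic_def mult.left_commute[of \<sigma>])

text \<open>
  Conditions satisfied by every solution whose right-hand sides have values between \<open>0\<close> and \<open>B\<close>
  and which has size at least \<open>b\<close>. All of them survive pointwise limits, and together they
  make the set compact.
\<close>

definition equicontinuous_part :: "real \<Rightarrow> real \<Rightarrow> (real \<Rightarrow>\<^sub>C (real^'n)) set" where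
  "equicontinuous_part b B = {u \<in> harnack_cone. b \<le> \<nu> u \<and> (\<forall>t i. u t $ i \<le> M * T * B) \<and>
     (\<forall>t\<in>{0..T}. \<forall>t'\<in>{0..T}. \<forall>i \<eta>. (\<forall>s\<in>{0..T}. \<bar>G i t s - G i t' s\<bar> \<le> \<eta>) \<longrightarrow>
        \<bar>u t $ i - u t' $ i\<bar> \<le> T * B * \<eta>)}"

lemma compact_equicontinuous_part:
  assumes "B > 0"
  shows "compact (equicontinuous_part b B)"
  unfolding compact_def
proof (intro allI impI)
  fix v :: "nat \<Rightarrow> real \<Rightarrow>\<^sub>C (real^'n)"
  assume v: "\<forall>n. v n \<in> equicontinuous_part b B"
  have per: "T_periodic T (v n)" and nn: "0 \<le> v n t $ i" and har: "\<sigma> * v n s $ i \<le> v n t $ i"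
    and \<nu>b: "b \<le> \<nu> (v n)" and bd: "v n t $ i \<le> M * T * B"
    and mod: "t \<in> {0..T} \<Longrightarrow> t' \<in> {0..T} \<Longrightarrow> (\<And>s. s \<in> {0..T} \<Longrightarrow> \<bar>G i t s - G i t' s\<bar> \<le> \<eta>)
       \<Longrightarrow> \<bar>v n t $ i - v n t' $ i\<bar> \<le> T * B * \<eta>" for n s t t' i \<eta>
    using v unfolding equicontinuous_part_def harnack_cone_def by blast+
  let ?N = "real CARD('n)"
  obtain l k where k: "strict_mono (k :: nat \<Rightarrow> nat)" and lim: "(\<lambda>n. v (k n)) \<longlonglongrightarrow> l"
  proof (rule periodic_Arzela_Ascoli[of T v "?N * (M * T * B)", OF T_pos per])
    fix n t assume "t \<in> {0..T}"
    have "norm (v n t) \<le> (\<Sum>i\<in>UNIV. \<bar>v n t $ i\<bar>)" by (rule norm_le_l1_cart)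
    also have "\<dots> \<le> (\<Sum>i\<in>(UNIV::'n set). M * T * B)" using nn bd by (intro sum_mono) simp
    finally show "norm (v n t) \<le> ?N * (M * T * B)" by simp
  next
    fix t e :: real assume t: "t \<in> {0..T}" and "e > 0"
    define \<eta> where "\<eta> = e / (2 * ?N * T * B)"
    have "\<eta> > 0" using \<open>e > 0\<close> \<open>B > 0\<close> T_pos by (simp add: \<eta>_def)
    then obtain d where "d > 0" and d: "\<And>i t t' s. t \<in> {0..T} \<Longrightarrow> t' \<in> {0..T} \<Longrightarrow> s \<in> {0..T} \<Longrightarrow> \<bar>t - t'\<bar> < d
       \<Longrightarrow> \<bar>G i t s - G i t' s\<bar> \<le> \<eta>"
      using G_equicontinuous by metis
    have "norm (v n t - v n s) < e" if "s \<in> {0..T}" "\<bar>t - s\<bar> < d" for n s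
    proof -
      have "norm (v n t - v n s) \<le> (\<Sum>i\<in>UNIV. \<bar>(v n t - v n s) $ i\<bar>)" by (rule norm_le_l1_cart)
      also have "\<dots> \<le> (\<Sum>i\<in>(UNIV::'n set). T * B * \<eta>)"
        using mod[OF t that(1) d[OF t that(1) _ that(2)]] by (intro sum_mono) simp
      also have "\<dots> = e / 2" using T_pos \<open>B > 0\<close> by (simp add: \<eta>_def)
      finally show ?thesis using \<open>e > 0\<close> by simp
    qed
    then show "\<exists>d>0. \<forall>n s. s \<in> {0..T} \<and> norm (t - s) < d \<longrightarrow> norm (v n t - v n s) < e"
      using \<open>d > 0\<close> by auto
  qed
  have pt: "(\<lambda>n. v (k n) t) \<longlonglongrightarrow> l t" for t using bcontfun_tendsto_pointwise[OF lim] .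
  have pti: "(\<lambda>n. v (k n) t $ i) \<longlonglongrightarrow> l t $ i" for t i using tendsto_vec_nth[OF pt] .
  have "l \<in> equicontinuous_part b B"
    unfolding equicontinuous_part_def harnack_cone_def
  proof (intro CollectI conjI allI ballI impI)
    have "l (t + T) = l t" for t
      using LIMSEQ_unique[OF pt[of "t + T"]] pt[of t] per by (simp add: T_periodic_def)
    then show "T_periodic T l" by (simp add: T_periodic_def)
    show "0 \<le> l t $ i" for t i by (rule LIMSEQ_le_const[OF pti]) (use nn in blast)
    show "\<sigma> * l s $ i \<le> l t $ i" for s t i
      by (rule LIMSEQ_le[OF tendsto_mult_left[OF pti] pti]) (use har in blast)
    show "l t $ i \<le> M * T * B" for t i by (rule LIMSEQ_le_const2[OF pti]) (use bd in blast)
    have "(\<lambda>n. \<nu> (v (k n))) \<longlonglongrightarrow> \<nu> l" unfolding \<nu>_def by (intro tendsto_sum pti)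
    then show "b \<le> \<nu> l" by (rule LIMSEQ_le_const) (use \<nu>b in blast)
    show "\<bar>l t $ i - l t' $ i\<bar> \<le> T * B * \<eta>"
      if "t \<in> {0..T}" "t' \<in> {0..T}" "\<forall>s\<in>{0..T}. \<bar>G i t s - G i t' s\<bar> \<le> \<eta>" for t t' i \<eta>
    proof (rule LIMSEQ_le_const2[OF tendsto_rabs[OF tendsto_diff[OF pti pti]]])
      show "\<exists>N. \<forall>n\<ge>N. \<bar>v (k n) t $ i - v (k n) t' $ i\<bar> \<le> T * B * \<eta>" using mod that by blast
    qed
  qed
  then show "\<exists>l\<in>equicontinuous_part b B. \<exists>k. strict_mono (k :: nat \<Rightarrow> nat) \<and> (v \<circ> k) \<longlonglongrightarrow> l"
    using k lim by (auto simp: o_def)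
qed

lemma vec_solution:
  assumes "\<And>i. continuous_on UNIV (h i)" "\<And>i. T_periodic T (h i)" and x: "\<And>t. x t = (\<chi> i. sol i (h i) t)"
  shows "\<exists>x2. C2_with x x2 \<and> (\<forall>t i. x2 t $ i + a i t * x t $ i = h i t)"
proof -
  have "\<exists>x1 x2. (\<forall>t. (sol i (h i) has_vector_derivative x1 t) (at t)) \<and>
      (\<forall>t. (x1 has_vector_derivative x2 t) (at t)) \<and> continuous_on UNIV x2 \<and>
      (\<forall>t. x2 t + a i t * sol i (h i) t = h i t)" for i
    using sol_solves[OF assms(1,2), of i] unfolding scalar_periodic_solution_def C2_with_def by blast
  then obtain x1 x2 where D1: "\<And>i t. (sol i (h i) has_vector_derivative x1 i t) (at t)"
    and D2: "\<And>i t. (x1 i has_vector_derivative x2 i t) (at t)" and cont: "\<And>i. continuous_on UNIV (x2 i)"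
    and eq: "\<And>i t. x2 i t + a i t * sol i (h i) t = h i t" by metis
  have xeq: "x = (\<lambda>t. \<chi> i. sol i (h i) t)" using x by blast
  have "C2_with x (\<lambda>t. \<chi> i. x2 i t)"
    unfolding C2_with_def xeq
    by (rule exI[of _ "\<lambda>t. \<chi> i. x1 i t"])
       (auto intro!: has_vector_derivative_vec_lambda D1 D2 continuous_on_vec_lambda cont)
  then show ?thesis using eq x by (intro exI[of _ "\<lambda>t. \<chi> i. x2 i t"]) auto
qed

text \<open>
  The system \<open>x\<^sub>i'' + a\<^sub>i x\<^sub>i = N\<^sub>i(t, x)\<close> is the fixed point equation for the map \<open>F\<close> that inserts
  \<open>u\<close> into \<open>N\<close> and solves the linear problems. Since \<open>N\<close> is positive and bounded on the compact
  annulus, \<open>F\<close> maps the slab into a compact part of the cone; \<^const>\<open>pushes_out\<close> and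
  \<^const>\<open>pulls_in\<close> give the boundary conditions of the slab theorem.
\<close>

theorem periodic_solution_in_annulus:
  fixes N :: "'n \<Rightarrow> real \<Rightarrow> real^'n \<Rightarrow> real"
  assumes N_cont: "\<And>i. continuous_on (UNIV \<times> (UNIV - {0})) (\<lambda>(t, y). N i t y)"
    and N_per: "\<And>i y. T_periodic T (\<lambda>t. N i t y)"
    and "0 < p" "p \<le> q"
    and N_pos: "\<And>i t y. t \<in> {0..T} \<Longrightarrow> y \<in> annulus p q \<Longrightarrow> N i t y > 0"
    and boundary:
      "pushes_out N p \<and> pulls_in N q \<or> pulls_in N p \<and> pushes_out N q"
  obtains x where "T_periodic T x" "\<exists>x2. C2_with x x2 \<and> (\<forall>t i. x2 t $ i + a i t * x t $ i = N i t (x t))"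
    "\<And>t i. x t $ i > 0" "p \<le> l1norm (x 0)" "l1norm (x 0) \<le> q"
proof -
  let ?R = "{0..T} \<times> annulus p q"
  define S where "S = {u \<in> harnack_cone. p \<le> \<nu> u \<and> \<nu> u \<le> q}"
  define rhs where "rhs u i s = N i s (apply_bcontfun u s)" for u :: "real \<Rightarrow>\<^sub>C (real^'n)" and i s
  have ann: "u t \<in> annulus p q" if "u \<in> S" for u t
    using harnack_cone_in_annulus that unfolding S_def by blast
  have S_per: "T_periodic T u" if "u \<in> S" for u using that by (auto simp: S_def harnack_cone_def)
  have rhs_cont: "continuous_on UNIV (rhs u i)" if "u \<in> S" for u i
  proof -
    have "continuous_on UNIV (\<lambda>s. (\<lambda>(t, y). N i t y) (s, u s))"
      by (rule continuous_on_compose2[OF N_cont])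
         (use annulus_nonzero[OF ann[OF that] \<open>0 < p\<close>] in \<open>auto intro!: continuous_intros\<close>)
    then show ?thesis by (simp add: rhs_def[abs_def])
  qed
  have rhs_per: "T_periodic T (rhs u i)" if "u \<in> S" for u i
    using S_per[OF that] N_per unfolding T_periodic_def rhs_def by metis

  have N_contR: "continuous_on ?R (\<lambda>(t, y). N i t y)" for i
    by (rule continuous_on_subset[OF N_cont]) (use annulus_nonzero[OF _ \<open>0 < p\<close>] in auto)
  have cR: "compact ?R" by (intro compact_Times compact_annulus compact_Icc)
  have "\<exists>b>0. \<exists>B>0. \<forall>t\<in>{0..T}. \<forall>y\<in>annulus p q. b \<le> N i t y \<and> N i t y \<le> B" for i
  proof (cases "?R = {}")
    case True
    then show ?thesis using T_pos by (intro exI[of _ 1]) auto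
  next
    case False
    obtain z where z: "z \<in> ?R" "\<And>w. w \<in> ?R \<Longrightarrow> (\<lambda>(t, y). N i t y) z \<le> (\<lambda>(t, y). N i t y) w"
      using continuous_attains_inf[OF cR False N_contR] by blast
    obtain z' where z': "z' \<in> ?R" "\<And>w. w \<in> ?R \<Longrightarrow> (\<lambda>(t, y). N i t y) w \<le> (\<lambda>(t, y). N i t y) z'"
      using continuous_attains_sup[OF cR False N_contR] by blast
    show ?thesis using z z' N_pos
      by (intro exI[of _ "(\<lambda>(t, y). N i t y) z"] exI[of _ "(\<lambda>(t, y). N i t y) z'"] conjI) auto
  qed
  then obtain b0 B0 where bB0: "\<And>i. b0 i > 0" "\<And>i. B0 i > 0"
    "\<And>i t y. t \<in> {0..T} \<Longrightarrow> y \<in> annulus p q \<Longrightarrow> b0 i \<le> N i t y \<and> N i t y \<le> B0 i" by metis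
  define b where "b = Min (range b0)"
  define B where "B = Max (range B0)"
  have "b > 0" using bB0 by (simp add: b_def)
  have "b \<le> b0 i" "B0 i \<le> B" for i by (auto simp: b_def B_def)
  then have Nb: "b \<le> N i t y" and NB: "N i t y \<le> B" if "t \<in> {0..T}" "y \<in> annulus p q" for i t y
    using bB0(3)[OF that] order_trans by blast+
  have "B > 0" using bB0(2) \<open>\<And>i. B0 i \<le> B\<close> less_le_trans by blast
  have rhs_b: "b \<le> rhs u i s" and rhs_B: "rhs u i s \<le> B" if "u \<in> S" "s \<in> {0..T}" for u i s
    using Nb NB ann that by (auto simp: rhs_def)
  have rhs_nonneg: "0 \<le> rhs u i s" if "u \<in> S" "s \<in> {0..T}" for u i s
    using rhs_b[OF that] \<open>b > 0\<close> by (meson less_imp_le order_trans)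

  define F where "F u = Bcontfun (\<lambda>t. \<chi> i. sol i (rhs u i) t)" for u
  have F: "F u t = (\<chi> i. sol i (rhs u i) t)" if "u \<in> S" for u t
  proof -
    note sp = rhs_cont[OF that] rhs_per[OF that]
    have "(\<lambda>t. \<chi> i. sol i (rhs u i) t) \<in> bcontfun"
    proof (rule bcontfun_normI)
      show "continuous_on UNIV (\<lambda>t. \<chi> i. sol i (rhs u i) t)"
        by (intro continuous_on_vec_lambda sol_continuous sp)
      fix t
      have "norm (\<chi> i. sol i (rhs u i) t) \<le> (\<Sum>i\<in>UNIV. \<bar>(\<chi> i. sol i (rhs u i) t) $ i\<bar>)"
        by (rule norm_le_l1_cart)
      also have "\<dots> \<le> (\<Sum>i\<in>(UNIV::'n set). M * T * B)"
      proof (rule sum_mono)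
        fix i
        have "0 \<le> sol i (rhs u i) t" using sol_ge[OF sp, where c=0 and t=t and i=i] rhs_nonneg[OF that] by simp
        moreover have "sol i (rhs u i) t \<le> M * T * B"
          using sol_le[OF sp rhs_nonneg[OF that] rhs_B[OF that]] .
        ultimately show "\<bar>(\<chi> i. sol i (rhs u i) t) $ i\<bar> \<le> M * T * B" by simp
      qed
      finally show "norm (\<chi> i. sol i (rhs u i) t) \<le> (\<Sum>i\<in>(UNIV::'n set). M * T * B)" .
    qed
    then show ?thesis unfolding F_def by (simp add: Bcontfun_inverse)
  qed
  let ?C = "equicontinuous_part (m * T * b) B"
  have FC: "F u \<in> ?C" if "u \<in> S" for u
  proof -
    note sp = rhs_cont[OF that] rhs_per[OF that]
    note nonneg = rhs_nonneg[OF that]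
    have low: "m * T * b \<le> sol i (rhs u i) t" for i t
      using sol_ge[OF sp _ rhs_b[OF that]] \<open>b > 0\<close> by simp
    have mTb: "0 < m * T * b" using m_pos T_pos \<open>b > 0\<close> by simp
    have comp: "F u t $ i = sol i (rhs u i) t" for t i by (simp add: F[OF that])
    show ?thesis unfolding equicontinuous_part_def harnack_cone_def
    proof (intro CollectI conjI allI ballI impI)
      show "T_periodic T (F u)"
        using sol_periodic[OF sp] by (simp add: T_periodic_def F[OF that])
      show "0 \<le> F u t $ i" for t i using low[of i t] mTb by (simp add: comp)
      show "\<sigma> * F u s $ i \<le> F u t $ i" for s t i
        using sol_harnack[OF sp nonneg] by (simp add: comp)
      show "F u t $ i \<le> M * T * B" for t i
        using sol_le[OF sp nonneg rhs_B[OF that]] by (simp add: comp)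
      have "m * T * b \<le> (\<Sum>i\<in>(UNIV::'n set). m * T * b)" using mTb by (rule le_sum_const)
      also have "\<dots> \<le> \<nu> (F u)" unfolding \<nu>_def using low by (intro sum_mono) (simp add: comp)
      finally show "m * T * b \<le> \<nu> (F u)" .
      show "\<bar>F u t $ i - F u t' $ i\<bar> \<le> T * B * \<eta>"
        if "t \<in> {0..T}" "t' \<in> {0..T}" "\<forall>s\<in>{0..T}. \<bar>G i t s - G i t' s\<bar> \<le> \<eta>" for t t' i \<eta>
        using sol_modulus[OF sp, where B=B and t=t and t'=t' and i=i and \<eta>=\<eta>] that nonneg rhs_B[OF \<open>u \<in> S\<close>] by (simp add: comp)
    qed
  qed
  have contF: "continuous_on S F"
    unfolding continuous_on_iff
  proof (intro ballI allI impI)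
    fix u and e :: real assume u: "u \<in> S" and "e > 0"
    let ?n = "real CARD('n)"
    define \<eta> where "\<eta> = e / (2 * ?n * T * M)"
    have M: "M > 0" using m_pos m_le_M by linarith
    then have "\<eta> > 0" using \<open>e > 0\<close> T_pos by (simp add: \<eta>_def)
    have "uniformly_continuous_on ?R (\<lambda>z. \<chi> i. N i (fst z) (snd z))"
      using cR N_contR by (intro compact_uniformly_continuous continuous_on_vec_lambda) (simp add: case_prod_unfold)
    then obtain d where "d > 0" and d: "\<And>z w. z \<in> ?R \<Longrightarrow> w \<in> ?R \<Longrightarrow> dist w z < d
        \<Longrightarrow> dist ((\<lambda>z. \<chi> i. N i (fst z) (snd z)) w) ((\<lambda>z. \<chi> i. N i (fst z) (snd z)) z) < \<eta>"
      using \<open>\<eta> > 0\<close> unfolding uniformly_continuous_on_def by metis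
    have "dist (F v) (F u) < e" if v: "v \<in> S" and "dist v u < d" for v
    proof -
      have rd: "\<bar>rhs v i s - rhs u i s\<bar> \<le> \<eta>" if s: "s \<in> {0..T}" for i s
      proof -
        have "dist (v s) (u s) < d" using \<open>dist v u < d\<close> dist_bounded[of v s u] by linarith
        then have "dist (s, v s) (s, u s) < d" by (simp add: dist_Pair_Pair)
        then have "dist (\<chi> i. N i s (v s)) (\<chi> i. N i s (u s)) < \<eta>"
          using d[of "(s, u s)" "(s, v s)"] s ann u v by simp
        then have "norm ((\<chi> i. N i s (v s)) - (\<chi> i. N i s (u s))) < \<eta>" by (simp add: dist_norm)
        moreover have "\<bar>((\<chi> i. N i s (v s)) - (\<chi> i. N i s (u s))) $ i\<bar> \<le> norm ((\<chi> i. N i s (v s)) - (\<chi> i. N i s (u s)))"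
          by (rule component_le_norm_cart)
        ultimately show ?thesis by (simp add: rhs_def)
      qed
      have "dist (F v) (F u) \<le> ?n * (T * M * \<eta>)"
      proof (rule periodic_bcontfun_dist_le[OF T_pos])
        show "T_periodic T (F v)" "T_periodic T (F u)"
          using FC[OF u] FC[OF v] by (auto simp: equicontinuous_part_def harnack_cone_def)
        fix t assume t: "t \<in> {0..T}"
        have "norm (F v t - F u t) \<le> (\<Sum>i\<in>UNIV. \<bar>(F v t - F u t) $ i\<bar>)" by (rule norm_le_l1_cart)
        also have "\<dots> \<le> (\<Sum>i\<in>(UNIV::'n set). T * M * \<eta>)"
        proof (rule sum_mono)
          fix i
          show "\<bar>(F v t - F u t) $ i\<bar> \<le> T * M * \<eta>"
            using sol_diff[OF rhs_cont[OF v] rhs_per[OF v] rhs_cont[OF u] rhs_per[OF u] rd t] F u v by simp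
        qed
        finally show "norm (F v t - F u t) \<le> ?n * (T * M * \<eta>)" by simp
      qed
      also have "\<dots> = e / 2" using T_pos M by (simp add: \<eta>_def)
      finally show ?thesis using \<open>e > 0\<close> by simp
    qed
    then show "\<exists>d>0. \<forall>v\<in>S. dist v u < d \<longrightarrow> dist (F v) (F u) < e" using \<open>d > 0\<close> by blast
  qed
  have \<nu>F_ge: "r \<le> \<nu> (F u)"
    if u: "u \<in> S" and r: "\<nu> u = r" and b: "pushes_out N r" for u r
  proof -
    have mT: "m * T > 0" using m_pos T_pos by simp
    have "r > 0" using u r \<open>0 < p\<close> by (auto simp: S_def)
    have ur: "u s \<in> annulus r r" for s using harnack_cone_in_annulus u r by (auto simp: S_def)
    have "r / (m * T) \<le> rhs u i s" if "s \<in> {0..T}" for i s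
      using b that ur mT by (simp add: pushes_out_def rhs_def pos_divide_le_eq mult.commute)
    then have "m * T * (r / (m * T)) \<le> sol i (rhs u i) 0" for i
      using mT \<open>r > 0\<close> by (intro sol_ge[OF rhs_cont[OF u] rhs_per[OF u]]) auto
    moreover have "m * T * (r / (m * T)) = r" 
      using mT by (metis less_irrefl nonzero_mult_div_cancel_left times_divide_eq_right)
    ultimately have sr: "r \<le> sol i (rhs u i) 0" for i by simp
    have "r \<le> (\<Sum>i\<in>(UNIV::'n set). r)" using \<open>r > 0\<close> by (rule le_sum_const)
    also have "\<dots> \<le> \<nu> (F u)" unfolding \<nu>_def F[OF u] using sr by (intro sum_mono) simp
    finally show ?thesis .
  qed
  have \<nu>F_le: "\<nu> (F u) \<le> r"
    if u: "u \<in> S" and r: "\<nu> u = r" and b: "pulls_in N r" for u r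
  proof -
    have MT: "M * T * CARD('n) > 0" using m_pos m_le_M T_pos by simp
    have ur: "u s \<in> annulus r r" for s using harnack_cone_in_annulus u r by (auto simp: S_def)
    have "rhs u i s \<le> r / (M * T * CARD('n))" if "s \<in> {0..T}" for i s
      using b that ur MT by (simp add: pulls_in_def rhs_def pos_le_divide_eq ac_simps)
    then have sr: "sol i (rhs u i) 0 \<le> M * T * (r / (M * T * CARD('n)))" for i
      by (intro sol_le[OF rhs_cont[OF u] rhs_per[OF u] rhs_nonneg[OF u]])
    have "\<nu> (F u) \<le> (\<Sum>i\<in>(UNIV::'n set). M * T * (r / (M * T * CARD('n))))"
      unfolding \<nu>_def F[OF u] using sr by (intro sum_mono) simp
    also have "\<dots> = r" using m_pos m_le_M T_pos by simp
    finally show ?thesis .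
  qed
  obtain u where u: "u \<in> {u \<in> harnack_cone. p \<le> \<nu> u \<and> \<nu> u \<le> q}" "F u = u"
  proof (rule slab_fixed_point[OF convex_harnack_cone harnack_cone_scaleR bounded_linear_\<nu> \<open>0 < p\<close> \<open>p \<le> q\<close>, of F ?C])
    \<comment> \<open>A constant function of size \<open>p\<close> shows that the slab is inhabited.\<close>
    let ?w = "const_bcontfun (\<chi> i. p / CARD('n)) :: real \<Rightarrow>\<^sub>C (real^'n)"
    have "\<nu> ?w = p" by (simp add: \<nu>_def const_bcontfun.rep_eq)
    moreover have "?w \<in> harnack_cone"
    proof -
      have "\<sigma> * (p / CARD('n)) \<le> p / CARD('n)"
        using \<sigma> \<open>0 < p\<close> by (intro mult_left_le_one_le) auto
      then show ?thesis using \<open>0 < p\<close> by (simp add: harnack_cone_def T_periodic_def const_bcontfun.rep_eq)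
    qed
    ultimately have "?w \<in> {x \<in> harnack_cone. p \<le> \<nu> x \<and> \<nu> x \<le> q}" using \<open>p \<le> q\<close> by simp
    then show "{x \<in> harnack_cone. p \<le> \<nu> x \<and> \<nu> x \<le> q} \<noteq> {}" by blast
    show "continuous_on {x \<in> harnack_cone. p \<le> \<nu> x \<and> \<nu> x \<le> q} F" using contF by (simp add: S_def)
    show "F ` {x \<in> harnack_cone. p \<le> \<nu> x \<and> \<nu> x \<le> q} \<subseteq> ?C" using FC by (auto simp: S_def)
    show "compact ?C" using \<open>B > 0\<close> by (rule compact_equicontinuous_part)
    show "?C \<subseteq> harnack_cone" by (auto simp: equicontinuous_part_def)
    show "0 < \<nu> x" if "x \<in> ?C" for x
    proof -
      have "0 < m * T * b" using m_pos T_pos \<open>b > 0\<close> by simp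
      also have "\<dots> \<le> \<nu> x" using that by (simp add: equicontinuous_part_def)
      finally show ?thesis .
    qed
    have *: "{x \<in> harnack_cone. p \<le> \<nu> x \<and> \<nu> x \<le> q} = S" by (simp add: S_def)
    show "(\<forall>x\<in>{x \<in> harnack_cone. p \<le> \<nu> x \<and> \<nu> x \<le> q}. (\<nu> x = p \<longrightarrow> p \<le> \<nu> (F x)) \<and> (\<nu> x = q \<longrightarrow> \<nu> (F x) \<le> q)) \<or>
       (\<forall>x\<in>{x \<in> harnack_cone. p \<le> \<nu> x \<and> \<nu> x \<le> q}. (\<nu> x = p \<longrightarrow> \<nu> (F x) \<le> p) \<and> (\<nu> x = q \<longrightarrow> q \<le> \<nu> (F x)))"
      using boundary unfolding *
    proof (rule disj_forward)
    qed (intro ballI conjI impI \<nu>F_ge \<nu>F_le; blast)+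
  qed
  then have uS: "u \<in> S" by (simp add: S_def)
  note sp = rhs_cont[OF uS] rhs_per[OF uS]
  have ueq: "u t = (\<chi> i. sol i (rhs u i) t)" for t using F[OF uS] u(2) by simp
  show thesis
  proof (rule that[of u])
    show "T_periodic T u" using S_per[OF uS] .
    show "\<exists>x2. C2_with u x2 \<and> (\<forall>t i. x2 t $ i + a i t * u t $ i = N i t (u t))"
      using vec_solution[of "rhs u" u, OF sp ueq] by (simp add: rhs_def)
    show "u t $ i > 0" for t i
    proof -
      have "0 < m * T * b" using m_pos T_pos \<open>b > 0\<close> by simp
      also have "\<dots> \<le> sol i (rhs u i) t" using sol_ge[OF sp _ rhs_b[OF uS]] \<open>b > 0\<close> by simp
      finally show ?thesis using ueq by simp
    qed
    have "l1norm (u 0) = \<nu> u" using uS by (auto simp: S_def harnack_cone_def \<nu>_def l1norm_nonneg)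
    then show "p \<le> l1norm (u 0)" "l1norm (u 0) \<le> q" using uS by (auto simp: S_def)
  qed
qed
end

section \<open>The singular system with a parameter\<close>

lemma eventually_l1_infinity:
  "eventually P (l1_infinity :: (real^'n) filter) \<longleftrightarrow> (\<exists>r. \<forall>y. r \<le> l1norm y \<longrightarrow> P y)"
  unfolding l1_infinity_def by (rule eventually_filtercomap_at_top_linorder)

lemma continuous_family_bounds:
  fixes h :: "'n::finite \<Rightarrow> 'a::topological_space \<Rightarrow> real"
  assumes "compact K" "\<And>i. continuous_on K (h i)"
  shows "\<exists>B>0. \<forall>i. \<forall>x\<in>K. \<bar>h i x\<bar> \<le> B"
    and "(\<And>i x. x \<in> K \<Longrightarrow> h i x > 0) \<Longrightarrow> \<exists>b>0. \<forall>i. \<forall>x\<in>K. b \<le> h i x"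
proof -
  have "\<exists>B>0. \<forall>x\<in>K. \<bar>h i x\<bar> \<le> B" for i
    using compact_imp_bounded[OF compact_continuous_image[OF assms(2,1)], of i]
    by (auto simp: bounded_pos)
  then obtain B where "\<And>i. B i > 0" and B: "\<And>i x. x \<in> K \<Longrightarrow> \<bar>h i x\<bar> \<le> B i" by metis
  have "\<bar>h i x\<bar> \<le> Max (range B)" if "x \<in> K" for i x
    by (rule order_trans[OF B[OF that] Max_ge]) auto
  moreover have "Max (range B) > 0" using \<open>\<And>i. B i > 0\<close> by (subst Max_gr_iff) auto
  ultimately show "\<exists>B>0. \<forall>i. \<forall>x\<in>K. \<bar>h i x\<bar> \<le> B" by blast
next
  assume pos: "\<And>i x. x \<in> K \<Longrightarrow> h i x > 0"
  have "\<exists>b>0. \<forall>x\<in>K. b \<le> h i x" for i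
  proof (cases "K = {}")
    case False
    then show ?thesis using continuous_attains_inf[OF assms(1) False assms(2)[of i]] pos by blast
  qed (auto intro: exI[of _ 1])
  then obtain b where "\<And>i. b i > 0" and b: "\<And>i x. x \<in> K \<Longrightarrow> b i \<le> h i x" by metis
  have "Min (range b) \<le> h i x" if "x \<in> K" for i x
    by (rule order_trans[OF Min_le b[OF that]]) auto
  moreover have "Min (range b) > 0" using \<open>\<And>i. b i > 0\<close> by (subst Min_gr_iff) auto
  ultimately show "\<exists>b>0. \<forall>i. \<forall>x\<in>K. b \<le> h i x" by blast
qed

text \<open>
  The bounds \<open>g0\<close>, \<open>g1\<close>, \<open>E\<close> of the coefficients are fixed so that \<open>\<lambda>\<close> and the radii can be
  computed from them. Where \<open>f\<close> is at least \<open>(1 + E) / g0\<close>, the forcing term \<open>e\<close>, whatever its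
  sign, cannot make the right-hand side less than \<open>1\<close>.
\<close>

locale singular_system = green_bounds T a G m M
  for T :: real and a :: "'n::finite \<Rightarrow> real \<Rightarrow> real" and G m M +
  fixes f :: "'n \<Rightarrow> real^'n \<Rightarrow> real" and g e :: "'n \<Rightarrow> real \<Rightarrow> real" and g0 g1 E :: real
  assumes f_cont: "\<And>i. continuous_on (UNIV - {0}) (f i)"
    and f_pos: "\<And>i x. l1norm x > 0 \<Longrightarrow> f i x > 0"
    and g_cont: "\<And>i. continuous_on UNIV (g i)" and e_cont: "\<And>i. continuous_on UNIV (e i)"
    and g_per: "\<And>i. T_periodic T (g i)" and e_per: "\<And>i. T_periodic T (e i)"
    and g0: "g0 > 0" and E: "E > 0"
    and g_bounds: "\<And>i t. t \<in> {0..T} \<Longrightarrow> g0 \<le> g i t \<and> g i t \<le> g1"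
    and e_bound: "\<And>i t. t \<in> {0..T} \<Longrightarrow> \<bar>e i t\<bar> \<le> E"
    and f_at_0: "\<And>i. filterlim (f i) at_top (at 0)"
begin

definition H :: "'n \<Rightarrow> real \<Rightarrow> real^'n \<Rightarrow> real" where
  "H i t y = g i t * f i y + e i t"

abbreviation solution :: "real \<Rightarrow> (real \<Rightarrow> real^'n) \<Rightarrow> bool" where
  "solution \<equiv> positive_periodic_solution T a g e f"

lemma H_ge: "g0 * c - E \<le> H i t y" if "t \<in> {0..T}" "c \<le> f i y" "0 \<le> f i y"
proof -
  have "g0 * c \<le> g0 * f i y" using that g0 by simp
  also have "\<dots> \<le> g i t * f i y" using g_bounds that by (intro mult_right_mono) auto
  finally show ?thesis using e_bound[OF that(1), of i] by (simp add: H_def)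
qed

lemma H_le: "H i t y \<le> g1 * c + E" if "t \<in> {0..T}" "f i y \<le> c" "0 \<le> f i y"
proof -
  have "g i t * f i y \<le> g1 * c"
    using g_bounds[OF that(1), of i] g0 that by (intro mult_mono) auto
  then show ?thesis using e_bound[OF that(1), of i] by (simp add: H_def)
qed

lemma H_ge_1: "1 \<le> H i t y" if "t \<in> {0..T}" "(1 + E) / g0 \<le> f i y"
proof -
  have "0 \<le> (1 + E) / g0" using g0 E by simp
  then have "g0 * ((1 + E) / g0) - E \<le> H i t y" using that by (intro H_ge) auto
  then show ?thesis using g0 by simp
qed

lemma annulus_l1norm:
  assumes "y \<in> annulus p q" shows "\<sigma> * p \<le> l1norm y" "l1norm y \<le> q / \<sigma>"
  using assms by (auto simp: annulus_def)

lemma f_nonneg_annulus: "0 \<le> f i y" if "y \<in> annulus p q" "p > 0"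
  using f_pos[of y i] annulus_l1norm(1)[OF that(1)] mult_pos_pos[OF \<sigma>(1) that(2)] by fastforce

lemma H_bounded_annulus:
  assumes "p > 0"
  obtains B where "B > 0" "\<And>i t y. t \<in> {0..T} \<Longrightarrow> y \<in> annulus p q \<Longrightarrow> H i t y \<le> B"
proof -
  have "continuous_on (annulus p q) (f i)" for i
    using f_cont by (rule continuous_on_subset) (use annulus_nonzero assms in blast)
  then obtain B where "B > 0" and B: "\<And>i y. y \<in> annulus p q \<Longrightarrow> \<bar>f i y\<bar> \<le> B"
    using continuous_family_bounds(1)[OF compact_annulus, of p q f] by blast
  have "g1 > 0" using g0 g_bounds[of 0 undefined] T_pos by auto
  show thesis
  proof (rule that[of "g1 * B + E"])
    show "0 < g1 * B + E" using \<open>g1 > 0\<close> \<open>B > 0\<close> E by (simp add: add_pos_pos)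
    show "H i t y \<le> g1 * B + E" if "t \<in> {0..T}" "y \<in> annulus p q" for i t y
      using B[OF that(2), of i] f_nonneg_annulus[OF that(2) assms] by (intro H_le that) auto
  qed
qed

lemma solution_in_annulus:
  assumes "lam > 0" "0 < p" "p \<le> q"
    and H_pos: "\<And>i t y. t \<in> {0..T} \<Longrightarrow> y \<in> annulus p q \<Longrightarrow> H i t y > 0"
    and boundary:
      "pushes_out (\<lambda>i t y. lam * H i t y) p \<and> pulls_in (\<lambda>i t y. lam * H i t y) q \<or>
       pulls_in (\<lambda>i t y. lam * H i t y) p \<and> pushes_out (\<lambda>i t y. lam * H i t y) q"
  obtains x where "solution lam x" "p \<le> l1norm (x 0)" "l1norm (x 0) \<le> q"
proof -
  have "continuous_on (UNIV \<times> (UNIV - {0})) (\<lambda>(t, y). lam * H i t y)" for i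
    unfolding H_def case_prod_unfold
    by (intro continuous_intros continuous_on_compose2[OF g_cont] continuous_on_compose2[OF e_cont]
          continuous_on_compose2[OF f_cont]) auto
  moreover have "T_periodic T (\<lambda>t. lam * H i t y)" for i y
    using g_per e_per by (simp add: T_periodic_def H_def)
  moreover have "lam * H i t y > 0" if "t \<in> {0..T}" "y \<in> annulus p q" for i t y
    using H_pos[OF that] \<open>lam > 0\<close> by simp
  ultimately obtain x where x: "T_periodic T x"
    "\<exists>x2. C2_with x x2 \<and> (\<forall>t i. x2 t $ i + a i t * x t $ i = lam * H i t (x t))"
    "\<And>t i. x t $ i > 0" "p \<le> l1norm (x 0)" "l1norm (x 0) \<le> q"
    using periodic_solution_in_annulus[of "\<lambda>i t y. lam * H i t y", OF _ _ \<open>0 < p\<close> \<open>p \<le> q\<close> _ boundary] by blast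
  then have "solution lam x"
    by (simp add: positive_periodic_solution_def H_def distrib_left mult.assoc)
  then show thesis using that x by blast
qed

lemma H_ge_1_near_0:
  obtains r where "r > 0" "\<And>i t y. t \<in> {0..T} \<Longrightarrow> 0 < l1norm y \<Longrightarrow> l1norm y < r \<Longrightarrow> 1 \<le> H i t y"
proof -
  have "eventually (\<lambda>y. \<forall>i. (1 + E) / g0 \<le> f i y) (at 0)"
    using f_at_0 unfolding filterlim_at_top by (intro eventually_all_finite) blast
  then obtain r where "r > 0" and r: "\<And>y i. y \<noteq> 0 \<Longrightarrow> dist y 0 < r \<Longrightarrow> (1 + E) / g0 \<le> f i y"
    unfolding eventually_at by auto
  have "1 \<le> H i t y" if "t \<in> {0..T}" "0 < l1norm y" "l1norm y < r" for i t y
  proof (rule H_ge_1[OF that(1)], rule r)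
    show "y \<noteq> 0" using that by (auto simp: l1norm_def)
    show "dist y 0 < r" using that norm_le_l1_cart[of y] by (simp add: l1norm_def)
  qed
  then show thesis using that \<open>r > 0\<close> by blast
qed

text \<open>
  Near the origin \<^term>\<open>H\<close> is at least \<open>1\<close>. Fix a sphere of radius \<open>R\<close> there; \<^term>\<open>H\<close> is
  bounded over it, so for small \<open>\<lambda>\<close> it pulls in. Since \<open>\<lambda> H \<ge> \<lambda>\<close>, every smaller sphere of
  radius at most \<open>\<lambda> m T\<close> pushes out. This is the compressive case, with \<open>R\<close>
  independent of \<open>\<lambda>\<close>.
\<close>

lemma small_solutions:
  obtains R lam1 where "R > 0" "lam1 > 0"
    "\<And>lam. 0 < lam \<Longrightarrow> lam < lam1 \<Longrightarrow> \<exists>x. solution lam x \<and> l1norm (x 0) \<le> R"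
proof -
  obtain r where "r > 0" and
    r: "\<And>i t y. t \<in> {0..T} \<Longrightarrow> 0 < l1norm y \<Longrightarrow> l1norm y < r \<Longrightarrow> 1 \<le> H i t y"
    using H_ge_1_near_0 by blast
  define R where "R = \<sigma> * (r / 2)"
  have R: "R > 0" "R / \<sigma> < r" using \<open>r > 0\<close> \<sigma> by (auto simp: R_def)
  have mT: "m * T > 0" and MT: "M * T * CARD('n) > 0" using m_pos m_le_M T_pos by simp_all
  obtain B where "B > 0" and B: "\<And>i t y. t \<in> {0..T} \<Longrightarrow> y \<in> annulus R R \<Longrightarrow> H i t y \<le> B"
    using H_bounded_annulus[OF R(1)] by blast
  show thesis
  proof (rule that[of R "R / (M * T * CARD('n) * B)"])
    show "0 < R / (M * T * CARD('n) * B)" using R MT \<open>B > 0\<close> by simp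
    fix lam assume "0 < lam" and lam: "lam < R / (M * T * CARD('n) * B)"
    define p where "p = min R (lam * (m * T))"
    have p: "0 < p" "p \<le> R" "p \<le> lam * (m * T)" using R mT \<open>0 < lam\<close> by (auto simp: p_def)
    have H1: "1 \<le> H i t y" if "t \<in> {0..T}" "y \<in> annulus s s'" "s > 0" "s' \<le> R" for i t y s s'
    proof (rule r[OF that(1)])
      show "0 < l1norm y" using annulus_l1norm(1)[OF that(2)] mult_pos_pos[OF \<sigma>(1) that(3)] by linarith
      have "s' / \<sigma> \<le> R / \<sigma>" using that \<sigma> by (simp add: divide_right_mono)
      then show "l1norm y < r" using annulus_l1norm(2)[OF that(2)] R by linarith
    qed
    obtain x where "solution lam x" "l1norm (x 0) \<le> R"
    proof (rule solution_in_annulus[OF \<open>0 < lam\<close> p(1,2)])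
      show "0 < H i t y" if "t \<in> {0..T}" "y \<in> annulus p R" for i t y
        by (rule less_le_trans[OF zero_less_one H1[OF that p(1) order_refl]])
      have "p \<le> m * T * (lam * H i t y)" if "t \<in> {0..T}" "y \<in> annulus p p" for i t y
      proof -
        have "lam * (m * T) * 1 \<le> lam * (m * T) * H i t y"
          using H1[OF that p(1,2)] mT \<open>0 < lam\<close> by (intro mult_left_mono) auto
        then show ?thesis using p(3) by (simp add: ac_simps)
      qed
      moreover have "M * T * (CARD('n) * (lam * H i t y)) \<le> R" if "t \<in> {0..T}" "y \<in> annulus R R" for i t y
      proof -
        have "(M * T * CARD('n) * lam) * H i t y \<le> (M * T * CARD('n) * lam) * B"
          using B[OF that] MT \<open>0 < lam\<close> by (intro mult_left_mono) auto
        also have "\<dots> = lam * (M * T * CARD('n) * B)" by simp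
        also have "\<dots> \<le> R" using lam MT \<open>B > 0\<close> by (simp add: pos_less_divide_eq)
        finally show ?thesis by (simp add: ac_simps)
      qed
      ultimately show "pushes_out (\<lambda>i t y. lam * H i t y) p \<and> pulls_in (\<lambda>i t y. lam * H i t y) R \<or>
          pulls_in (\<lambda>i t y. lam * H i t y) p \<and> pushes_out (\<lambda>i t y. lam * H i t y) R"
        unfolding pushes_out_def pulls_in_def by blast
    qed
    then show "\<exists>x. solution lam x \<and> l1norm (x 0) \<le> R" by blast
  qed (fact R(1))
qed

text \<open>
  Over all functions of size at least a fixed \<open>p\<close> the right-hand side is at least \<open>\<lambda>\<close>, so the sphere of radius \<open>p\<close>
  pushes out once \<open>\<lambda> \<ge> p / (m T)\<close>. For fixed \<open>\<lambda>\<close> sublinear growth makes every very large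
  sphere pull in.
\<close>

lemma solutions_for_large_lam:
  assumes f_inf: "\<And>i. filterlim (f i) at_top l1_infinity"
    and sublinear: "\<And>i. ((\<lambda>x. f i x / l1norm x) \<longlongrightarrow> 0) l1_infinity"
  shows "\<exists>lam0>0. \<forall>lam>lam0. \<exists>x. solution lam x"
proof -
  have "eventually (\<lambda>y. \<forall>i. (1 + E) / g0 \<le> f i y) l1_infinity"
    using f_inf unfolding filterlim_at_top by (intro eventually_all_finite) blast
  then obtain r where r: "\<And>y i. r \<le> l1norm y \<Longrightarrow> (1 + E) / g0 \<le> f i y"
    unfolding eventually_l1_infinity by blast
  define p where "p = max 1 (r / \<sigma>)"
  have p: "p > 0" "r \<le> \<sigma> * p"
  proof -
    have "r / \<sigma> \<le> p" by (simp add: p_def)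
    then show "r \<le> \<sigma> * p" using \<sigma> by (simp add: pos_divide_le_eq mult.commute)
  qed (simp add: p_def)
  have H1: "1 \<le> H i t y" if "t \<in> {0..T}" "y \<in> annulus p q" for i t y q
    using annulus_l1norm(1)[OF that(2)] p by (intro H_ge_1 r that) linarith
  have mT: "m * T > 0" and MT: "M * T * CARD('n) > 0" using m_pos m_le_M T_pos by simp_all
  have "g1 > 0" using g0 g_bounds[of 0 undefined] T_pos by auto
  have "\<exists>x. solution lam x" if lam: "lam > p / (m * T)" for lam
  proof -
    have "lam > 0" using lam p mT by (meson divide_pos_pos less_trans)
    define c where "c = M * T * CARD('n) * lam"
    have "c > 0" using MT \<open>lam > 0\<close> by (simp add: c_def)
    \<comment> \<open>This slope makes the sublinear part at most half of the radius on the outer sphere.\<close>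
    define \<epsilon> where "\<epsilon> = \<sigma> / (2 * c * g1)"
    have "\<epsilon> > 0" using \<sigma> \<open>c > 0\<close> \<open>g1 > 0\<close> by (simp add: \<epsilon>_def)
    have "eventually (\<lambda>y. \<forall>i. f i y / l1norm y < \<epsilon>) l1_infinity"
      using order_tendstoD(2)[OF sublinear \<open>\<epsilon> > 0\<close>] by (intro eventually_all_finite) blast
    then obtain r' where r': "\<And>y i. r' \<le> l1norm y \<Longrightarrow> f i y / l1norm y < \<epsilon>"
      unfolding eventually_l1_infinity by blast
    define q where "q = Max {p, r' / \<sigma>, 2 * c * E}"
    have q: "p \<le> q" "r' / \<sigma> \<le> q" "2 * c * E \<le> q" by (auto simp: q_def)
    then have "q > 0" "r' \<le> \<sigma> * q" using p \<sigma> by (auto simp: pos_divide_le_eq mult.commute)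
    obtain x where "solution lam x"
    proof (rule solution_in_annulus[OF \<open>lam > 0\<close> p(1) q(1)])
      show "0 < H i t y" if "t \<in> {0..T}" "y \<in> annulus p q" for i t y using H1[OF that, of i] by simp
      have "p \<le> m * T * (lam * H i t y)" if "t \<in> {0..T}" "y \<in> annulus p p" for i t y
      proof -
        have "lam * (m * T) * 1 \<le> lam * (m * T) * H i t y"
          using H1[OF that] mT \<open>lam > 0\<close> by (intro mult_left_mono) auto
        moreover have "p \<le> lam * (m * T)" using lam mT by (simp add: pos_divide_less_eq)
        ultimately show ?thesis by (simp add: ac_simps)
      qed
      moreover have "M * T * (CARD('n) * (lam * H i t y)) \<le> q" if t: "t \<in> {0..T}" and y: "y \<in> annulus q q" for i t y
      proof -
        note ly = annulus_l1norm[OF y]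
        have "l1norm y > 0" using ly mult_pos_pos[OF \<sigma>(1) \<open>q > 0\<close>] by linarith
        have "f i y / l1norm y < \<epsilon>" using ly \<open>r' \<le> \<sigma> * q\<close> by (intro r') linarith
        then have "f i y \<le> \<epsilon> * l1norm y" using \<open>l1norm y > 0\<close> by (simp add: pos_divide_less_eq)
        also have "\<dots> \<le> \<epsilon> * (q / \<sigma>)" using ly \<open>\<epsilon> > 0\<close> by (intro mult_left_mono) auto
        finally have "H i t y \<le> g1 * (\<epsilon> * (q / \<sigma>)) + E"
          using f_nonneg_annulus[OF y \<open>q > 0\<close>] t by (intro H_le)
        then have "c * H i t y \<le> c * (g1 * (\<epsilon> * (q / \<sigma>)) + E)" using \<open>c > 0\<close> by simp
        also have "\<dots> = q / 2 + c * E" using \<open>c > 0\<close> \<open>g1 > 0\<close> \<sigma> by (simp add: \<epsilon>_def field_simps)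
        also have "\<dots> \<le> q" using q(3) by linarith
        finally show ?thesis by (simp add: c_def ac_simps)
      qed
      ultimately show "pushes_out (\<lambda>i t y. lam * H i t y) p \<and> pulls_in (\<lambda>i t y. lam * H i t y) q \<or>
          pulls_in (\<lambda>i t y. lam * H i t y) p \<and> pushes_out (\<lambda>i t y. lam * H i t y) q"
        unfolding pushes_out_def pulls_in_def by blast
    qed
    then show ?thesis by blast
  qed
  moreover have "p / (m * T) > 0" using p mT by simp
  ultimately show ?thesis by blast
qed

text \<open>
  A sphere beyond any given radius \<open>R\<close>, and far enough for the right-hand side to be positive
  outside it, pulls in for small \<open>\<lambda>\<close>; by superlinear growth a much larger sphere pushes out,
  however small \<open>\<lambda>\<close> is. This is the expansive case.
\<close>

lemma large_solutions:
  assumes superlinear: "\<And>i. filterlim (\<lambda>x. f i x / l1norm x) at_top l1_infinity"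
  obtains lam1 where "lam1 > 0"
    "\<And>lam. 0 < lam \<Longrightarrow> lam < lam1 \<Longrightarrow> \<exists>x. solution lam x \<and> R < l1norm (x 0)"
proof -
  have grow: "\<exists>r. \<forall>y. r \<le> l1norm y \<longrightarrow> (\<forall>i. A \<le> f i y / l1norm y)" for A
  proof -
    have "eventually (\<lambda>y. \<forall>i. A \<le> f i y / l1norm y) l1_infinity"
      using superlinear unfolding filterlim_at_top by (intro eventually_all_finite) blast
    then show ?thesis unfolding eventually_l1_infinity .
  qed
  obtain r where r: "\<And>y i. r \<le> l1norm y \<Longrightarrow> (1 + E) / g0 \<le> f i y / l1norm y"
    using grow[of "(1 + E) / g0"] by blast
  define p where "p = Max {1 / \<sigma>, r / \<sigma>, R + 1}"
  have "1 / \<sigma> \<le> p" "r / \<sigma> \<le> p" "R + 1 \<le> p" by (auto simp: p_def)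
  then have p: "1 \<le> \<sigma> * p" "r \<le> \<sigma> * p" "R < p" using \<sigma> by (auto simp: pos_divide_le_eq mult.commute)
  have "p > 0" using \<open>1 / \<sigma> \<le> p\<close> \<sigma> by (meson divide_pos_pos less_le_trans zero_less_one)
  have H1: "1 \<le> H i t y" if "t \<in> {0..T}" "y \<in> annulus p q" for i t y q
  proof (rule H_ge_1[OF that(1)])
    have l: "1 \<le> l1norm y" "r \<le> l1norm y" using annulus_l1norm(1)[OF that(2)] p by linarith+
    have "(1 + E) / g0 * 1 \<le> (1 + E) / g0 * l1norm y" using l g0 E by (intro mult_left_mono) auto
    also have "\<dots> \<le> f i y" using r[OF l(2), of i] l by (simp add: pos_le_divide_eq)
    finally show "(1 + E) / g0 \<le> f i y" by simp
  qed
  have mT: "m * T > 0" and MT: "M * T * CARD('n) > 0" using m_pos m_le_M T_pos by simp_all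
  obtain B where "B > 0" and B: "\<And>i t y. t \<in> {0..T} \<Longrightarrow> y \<in> annulus p p \<Longrightarrow> H i t y \<le> B"
    using H_bounded_annulus[OF \<open>p > 0\<close>] by blast
  show thesis
  proof (rule that[of "p / (M * T * CARD('n) * B)"])
    show "0 < p / (M * T * CARD('n) * B)" using \<open>p > 0\<close> MT \<open>B > 0\<close> by simp
    fix lam assume "0 < lam" and lam: "lam < p / (M * T * CARD('n) * B)"
    define c where "c = m * T * lam"
    have "c > 0" using mT \<open>0 < lam\<close> by (simp add: c_def)
    \<comment> \<open>This slope makes the image exceed twice the radius of the outer sphere, up to the forcing term.\<close>
    define A where "A = 2 / (c * g0 * \<sigma>)"
    have "A > 0" using \<open>c > 0\<close> g0 \<sigma> by (simp add: A_def)
    obtain r' where r': "\<And>y i. r' \<le> l1norm y \<Longrightarrow> A \<le> f i y / l1norm y"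
      using grow[of A] by blast
    define q where "q = Max {p, r' / \<sigma>, c * E}"
    have q: "p \<le> q" "r' / \<sigma> \<le> q" "c * E \<le> q" by (auto simp: q_def)
    then have "q > 0" "r' \<le> \<sigma> * q" using \<open>p > 0\<close> \<sigma> by (auto simp: pos_divide_le_eq mult.commute)
    obtain x where "solution lam x" "p \<le> l1norm (x 0)"
    proof (rule solution_in_annulus[OF \<open>lam > 0\<close> \<open>p > 0\<close> q(1)])
      show "0 < H i t y" if "t \<in> {0..T}" "y \<in> annulus p q" for i t y using H1[OF that, of i] by simp
      have "M * T * (CARD('n) * (lam * H i t y)) \<le> p" if "t \<in> {0..T}" "y \<in> annulus p p" for i t y
      proof -
        have "(M * T * CARD('n) * lam) * H i t y \<le> (M * T * CARD('n) * lam) * B"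
          using B[OF that] MT \<open>0 < lam\<close> by (intro mult_left_mono) auto
        also have "\<dots> = lam * (M * T * CARD('n) * B)" by simp
        also have "\<dots> \<le> p" using lam MT \<open>B > 0\<close> by (simp add: pos_less_divide_eq)
        finally show ?thesis by (simp add: ac_simps)
      qed
      moreover have "q \<le> m * T * (lam * H i t y)" if t: "t \<in> {0..T}" and y: "y \<in> annulus q q" for i t y
      proof -
        note ly = annulus_l1norm[OF y]
        have "l1norm y > 0" using ly mult_pos_pos[OF \<sigma>(1) \<open>q > 0\<close>] by linarith
        have "A * (\<sigma> * q) \<le> A * l1norm y" using ly \<open>A > 0\<close> by (intro mult_left_mono) auto
        also have "\<dots> \<le> f i y"
          using r'[of y i] ly \<open>r' \<le> \<sigma> * q\<close> \<open>l1norm y > 0\<close> by (simp add: pos_le_divide_eq)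
        finally have "g0 * (A * (\<sigma> * q)) - E \<le> H i t y"
          using f_nonneg_annulus[OF y \<open>q > 0\<close>] t by (intro H_ge)
        then have "c * (g0 * (A * (\<sigma> * q)) - E) \<le> c * H i t y" using \<open>c > 0\<close> by simp
        moreover have "c * (g0 * (A * (\<sigma> * q)) - E) = 2 * q - c * E"
          using \<open>c > 0\<close> g0 \<sigma> by (simp add: A_def field_simps)
        ultimately have "q \<le> c * H i t y" using q(3) by linarith
        then show ?thesis by (simp add: c_def ac_simps)
      qed
      ultimately show "pushes_out (\<lambda>i t y. lam * H i t y) p \<and> pulls_in (\<lambda>i t y. lam * H i t y) q \<or>
          pulls_in (\<lambda>i t y. lam * H i t y) p \<and> pushes_out (\<lambda>i t y. lam * H i t y) q"
        unfolding pushes_out_def pulls_in_def by blast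
    qed
    then show "\<exists>x. solution lam x \<and> R < l1norm (x 0)" using p(3) by (meson less_le_trans)
  qed
qed

end

theorem theorem2p2:
  fixes T :: real
    and f :: "'n::finite \<Rightarrow> real^'n \<Rightarrow> real"
    and a g e :: "'n \<Rightarrow> real \<Rightarrow> real"
    and G :: "'n \<Rightarrow> real \<Rightarrow> real \<Rightarrow> real"
  assumes T_pos: "T > 0"
    and A_green: "\<And>i. is_periodic_green_function T (a i) (G i)"
    and A_pos: "\<And>i t s. t \<in> {0..T} \<Longrightarrow> s \<in> {0..T} \<Longrightarrow> G i t s > 0"
    and H1_cont: "\<And>i. continuous_on (UNIV - {0}) (f i)"
    and H1_pos: "\<And>i x. l1norm x > 0 \<Longrightarrow> f i x > 0"
    and H2_cont: "\<And>i. continuous_on UNIV (a i)" "\<And>i. continuous_on UNIV (g i)"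
      "\<And>i. continuous_on UNIV (e i)"
    and H2_periodic: "\<And>i. T_periodic T (a i)" "\<And>i. T_periodic T (g i)"
      "\<And>i. T_periodic T (e i)"
    and H2_nonneg: "\<And>i t. t \<in> {0..T} \<Longrightarrow> a i t \<ge> 0" "\<And>i t. t \<in> {0..T} \<Longrightarrow> g i t \<ge> 0"
    and H2_int: "\<And>i. integral {0..T} (g i) > 0"
    and H3: "\<And>i t. t \<in> {0..T} \<Longrightarrow> g i t > 0"
    and f_at_0: "\<And>i. filterlim (f i) at_top (at 0)"
  shows
    "((\<forall>i. filterlim (f i) at_top l1_infinity) \<and>
      (\<forall>i. ((\<lambda>x. f i x / l1norm x) \<longlongrightarrow> 0) l1_infinity) \<longrightarrow>
        (\<exists>lam0>0. \<forall>lam>lam0. \<exists>x. positive_periodic_solution T a g e f lam x)) \<and>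
     ((\<forall>i. filterlim (\<lambda>x. f i x / l1norm x) at_top l1_infinity) \<longrightarrow>
        (\<exists>lam_star>0. \<forall>lam. 0 < lam \<and> lam < lam_star \<longrightarrow>
           (\<exists>x y. x \<noteq> y \<and> positive_periodic_solution T a g e f lam x \<and>
                  positive_periodic_solution T a g e f lam y))) \<and>
     (\<exists>lam1>0. \<forall>lam. 0 < lam \<and> lam < lam1 \<longrightarrow>
        (\<exists>x. positive_periodic_solution T a g e f lam x))"
proof -
  have square: "compact ({0..T} \<times> {0..T})" by (intro compact_Times compact_Icc)
  have G_cont: "continuous_on ({0..T} \<times> {0..T}) (\<lambda>(t, s). G i t s)" for i
    using A_green[of i] by (simp add: is_periodic_green_function_def)
  have G_pos: "(\<lambda>(t, s). G i t s) z > 0" if "z \<in> {0..T} \<times> {0..T}" for i z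
    using that A_pos[of "fst z" "snd z" i] by (simp add: case_prod_unfold mem_Times_iff)
  have "\<exists>m>0. \<forall>i. \<forall>z\<in>{0..T} \<times> {0..T}. m \<le> (\<lambda>(t, s). G i t s) z"
    by (rule continuous_family_bounds(2)[OF square G_cont G_pos])
  then obtain m where "m > 0" and m: "\<And>i t s. t \<in> {0..T} \<Longrightarrow> s \<in> {0..T} \<Longrightarrow> m \<le> G i t s"
    by (auto simp del: atLeastAtMost_iff)
  have "\<exists>M>0. \<forall>i. \<forall>z\<in>{0..T} \<times> {0..T}. \<bar>(\<lambda>(t, s). G i t s) z\<bar> \<le> M"
    by (rule continuous_family_bounds(1)[OF square G_cont])
  then obtain M where M: "\<And>i t s. t \<in> {0..T} \<Longrightarrow> s \<in> {0..T} \<Longrightarrow> \<bar>G i t s\<bar> \<le> M"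
    by (auto simp del: atLeastAtMost_iff)
  have cont: "continuous_on {0..T} (g i)" "continuous_on {0..T} (e i)" for i
    using H2_cont continuous_on_subset by blast+
  obtain g0 where "g0 > 0" and g0: "\<And>i t. t \<in> {0..T} \<Longrightarrow> g0 \<le> g i t"
    using continuous_family_bounds(2)[of "{0..T}" g, OF compact_Icc cont(1) H3] by blast
  obtain g1 where g1: "\<And>i t. t \<in> {0..T} \<Longrightarrow> \<bar>g i t\<bar> \<le> g1"
    using continuous_family_bounds(1)[of "{0..T}" g, OF compact_Icc cont(1)] by blast
  obtain E where "E > 0" and E: "\<And>i t. t \<in> {0..T} \<Longrightarrow> \<bar>e i t\<bar> \<le> E"
    using continuous_family_bounds(1)[of "{0..T}" e, OF compact_Icc cont(2)] by blast
  interpret singular_system T a G m M f g e g0 g1 E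
  proof
    show "m \<le> G i t s \<and> G i t s \<le> M" if "t \<in> {0..T}" "s \<in> {0..T}" for i t s
      using m[OF that, of i] M[OF that, of i] by auto
    show "g0 \<le> g i t \<and> g i t \<le> g1" if "t \<in> {0..T}" for i t
      using g0[OF that, of i] g1[OF that, of i] by auto
    show "f i x > 0" if "l1norm x > 0" for i x using H1_pos[OF that] .
    show "\<bar>e i t\<bar> \<le> E" if "t \<in> {0..T}" for i t using E[OF that] .
  qed (fact T_pos A_green \<open>m > 0\<close> H1_cont H2_cont H2_periodic \<open>g0 > 0\<close> \<open>E > 0\<close> f_at_0)+
  obtain R lam1 where "lam1 > 0" and
    small: "\<And>lam. 0 < lam \<Longrightarrow> lam < lam1 \<Longrightarrow> \<exists>x. solution lam x \<and> l1norm (x 0) \<le> R"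
    using small_solutions by metis
  show ?thesis
  proof (intro conjI impI)
    show "\<exists>lam0>0. \<forall>lam>lam0. \<exists>x. solution lam x"
      if "(\<forall>i. filterlim (f i) at_top l1_infinity) \<and> (\<forall>i. ((\<lambda>x. f i x / l1norm x) \<longlongrightarrow> 0) l1_infinity)"
      using solutions_for_large_lam that by blast
    show "\<exists>lam1>0. \<forall>lam. 0 < lam \<and> lam < lam1 \<longrightarrow> (\<exists>x. solution lam x)"
      using \<open>lam1 > 0\<close> small by blast
    assume "\<forall>i. filterlim (\<lambda>x. f i x / l1norm x) at_top l1_infinity"
    then obtain lam2 where "lam2 > 0" and
      large: "\<And>lam. 0 < lam \<Longrightarrow> lam < lam2 \<Longrightarrow> \<exists>x. solution lam x \<and> R < l1norm (x 0)"
      using large_solutions[of R] by metis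
    have "\<exists>x y. x \<noteq> y \<and> solution lam x \<and> solution lam y" if lam: "0 < lam" "lam < min lam1 lam2" for lam
    proof -
      obtain x where "solution lam x" "l1norm (x 0) \<le> R" using small[of lam] lam by auto
      moreover obtain y where "solution lam y" "R < l1norm (y 0)" using large[of lam] lam by auto
      ultimately show ?thesis by (metis linorder_not_less)
    qed
    moreover have "min lam1 lam2 > 0" using \<open>lam1 > 0\<close> \<open>lam2 > 0\<close> by simp
    ultimately show "\<exists>lam_star>0. \<forall>lam. 0 < lam \<and> lam < lam_star \<longrightarrow>
        (\<exists>x y. x \<noteq> y \<and> solution lam x \<and> solution lam y)" by blast
  qed
qed

end
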